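(* Let $W\subset\mathbb{R}^d$ ($d\geq 1$) be a non-empty compact convex set with $\lambda_d(W)>0$, and for $s\geq 1$ let $\eta_s$ be a Poisson process on $\mathbb{R}^d$ with intensity measure $s\lambda_d|_W$. Fix $\varrho>0$, put $r_s=\varrho s^{-1/d}$, and let $V_j^{r_s}$ and $C_j^{r_s}$ denote the number of vertices of degree $j$ and the number of components of size $j$, respectively, in the random geometric graph $G_{r_s}$ generated by $\eta_s$ with radius $r_s$. Let $n\in\mathbb{N}$. a) Let $j_1,\dots,j_n\in\mathbb{N}_0$ be distinct. For $s\to\infty$ the asymptotic covariance matrix of $\frac{1}{\sqrt{s}}(V_{j_1}^{r_s},\dots,V_{j_n}^{r_s})$ is positive definite, i.e. for any $\alpha=(\alpha_1,\dots,\alpha_n)\in\mathbb{R}^n\setminus\{0\}$ there exists a constant $c>0$ such that for all $s$ sufficiently large $$\mathrm{Var}\left[\sum_{i=1}^{n}\alpha_iV_{j_i}^{r_s}\right]\geq cs.$$ b) Let $j_1,\dots,j_n\in\mathbb{N}$ be distinct. For $s\to\infty$ the asymptotic covariance matrix of $\frac{1}{\sqrt{s}}(C_{j_1}^{r_s},\dots,C_{j_n}^{r_s})$ is positive definite, i.e. for any $\alpha=(\alpha_1,\dots,\alpha_n)\in\mathbb{R}^n\setminus\{0\}$ there exists a constant $c>0$ such that for all $s$ sufficiently large $$\mathrm{Var}\left[\sum_{i=1}^{n}\alpha_iC_{j_i}^{r_s}\right]\geq cs.$$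
   Context: $\lambda_d$ is $d$-dimensional Lebesgue measure and $\lambda_d|_W$ its restriction to $W$. $\mathbb{N}=\{1,2,\dots\}$, $\mathbb{N}_0=\mathbb{N}\cup\{0\}$. The point process $\eta_s$ is identified with the random set of its points. The random geometric graph $G_{r_s}$ has vertex set $\eta_s$, and two distinct vertices $v_1,v_2\in\eta_s$ are joined by an edge iff $\lVert v_1-v_2\rVert\leq r_s$ (Euclidean norm). With $\mathrm{deg}(y,\eta_s)$ the degree of $y$ in $G_{r_s}$ and $|\mathrm{C}(y,\eta_s)|$ the number of vertices of the connected component of $y$ in $G_{r_s}$, $$V_j^{r_s}=\sum_{y\in\eta_s}\mathbf{1}\{\mathrm{deg}(y,\eta_s)=j\},\qquad C_j^{r_s}=\frac{1}{j}\sum_{y\in\eta_s}\mathbf{1}\{|\mathrm{C}(y,\eta_s)|=j\}.$$ "The asymptotic covariance matrix is positive definite" is to be understood as the variance lower bound stated after "i.e.". *)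

theory Defs
  imports "HOL-Probability.Probability"
begin

section \<open>Poisson processes\<close>

abbreviation point_count :: "'a set \<Rightarrow> 'a set \<Rightarrow> ennreal" where
  "point_count X B \<equiv> emeasure (count_space UNIV) (X \<inter> B)"

text \<open>
  A point process is identified with the random set \<open>\<eta>\<close> of its points, so \<open>point_count (\<eta> \<omega>) B\<close>
  is the number, possibly infinite, of points in \<open>B\<close>. In \<open>poisson_count\<close> the Poisson weights are
  written out because \<open>poisson_pmf\<close> requires a positive rate; since \<open>0 ^ 0 = 1\<close>, rate \<open>0\<close> gives the
  point mass at \<open>0\<close>. The Poisson distribution with infinite parameter is the point mass at
  \<open>\<infinity>\<close>. Finiteness of the configurations is not demanded of every outcome; if the intensity measure
  is finite, it holds almost surely by \<open>poisson_count\<close> with \<open>B = space \<mu>\<close>.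
\<close>

locale poisson_process = prob_space M
  for M :: "'w measure" and \<mu> :: "'a measure" and \<eta> :: "'w \<Rightarrow> 'a set" +
  assumes points_in_space: "\<And>\<omega>. \<omega> \<in> space M \<Longrightarrow> \<eta> \<omega> \<subseteq> space \<mu>"
    and measurable_count:
      "\<And>B. B \<in> sets \<mu> \<Longrightarrow> (\<lambda>\<omega>. point_count (\<eta> \<omega>) B) \<in> borel_measurable M"
    and poisson_count:
      "\<And>B k. B \<in> sets \<mu> \<Longrightarrow> emeasure \<mu> B < \<infinity> \<Longrightarrow>
         prob {\<omega> \<in> space M. point_count (\<eta> \<omega>) B = of_nat k} =
           measure \<mu> B ^ k / fact k * exp (- measure \<mu> B)"
    and infinite_count:
      "\<And>B. B \<in> sets \<mu> \<Longrightarrow> emeasure \<mu> B = \<infinity> \<Longrightarrow> AE \<omega> in M. point_count (\<eta> \<omega>) B = \<infinity>"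
    and indep_counts:
      "\<And>(B :: nat \<Rightarrow> 'a set) m. (\<And>i. i < m \<Longrightarrow> B i \<in> sets \<mu>) \<Longrightarrow> disjoint_family_on B {..<m} \<Longrightarrow>
         indep_vars (\<lambda>_. borel) (\<lambda>i \<omega>. point_count (\<eta> \<omega>) (B i)) {..<m}"

section \<open>Random geometric graphs\<close>

text \<open>The graph with vertex set \<open>X\<close> is given by its symmetric, irreflexive adjacency relation.\<close>

definition rgg_edges :: "real \<Rightarrow> 'a::real_normed_vector set \<Rightarrow> ('a \<times> 'a) set" where
  "rgg_edges r X = {(v, w). v \<in> X \<and> w \<in> X \<and> v \<noteq> w \<and> norm (v - w) \<le> r}"

definition rgg_degree :: "real \<Rightarrow> 'a::real_normed_vector set \<Rightarrow> 'a \<Rightarrow> nat" where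
  "rgg_degree r X y = card (rgg_edges r X `` {y})"

definition rgg_component :: "real \<Rightarrow> 'a::real_normed_vector set \<Rightarrow> 'a \<Rightarrow> 'a set" where
  "rgg_component r X y = (rgg_edges r X)\<^sup>* `` {y}"

text \<open>
  For infinite \<open>X\<close> the sums below are \<open>0\<close> by the convention for \<open>sum\<close>; for a Poisson process with
  finite intensity measure this concerns a null event only.
\<close>

definition degree_count :: "real \<Rightarrow> nat \<Rightarrow> 'a::real_normed_vector set \<Rightarrow> real" where
  "degree_count r j X = (\<Sum>y\<in>X. of_bool (rgg_degree r X y = j))"

definition component_count :: "real \<Rightarrow> nat \<Rightarrow> 'a::real_normed_vector set \<Rightarrow> real" where
  "component_count r j X = 1 / real j * (\<Sum>y\<in>X. of_bool (card (rgg_component r X y) = j))"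

end

theory Submission
  imports Defs
begin

text \<open>
  Pack order \<open>s\<close> disjoint balls of radius \<open>2 r\<close> into \<open>W\<close>; each consists of a core of radius
  \<open>r / 2\<close>, in which all points are adjacent, and a surrounding shell. Let \<open>T\<close> be the sum over the balls
  of bounded, centred, uncorrelated variables, each supported on the event that the shell is empty
  and comparing \<open>k\<close> points in the core with none. If the shell is empty, the functional is the core
  contribution, an explicit function of the number of core points, plus a functional of the points
  outside the ball, which is independent of the summand of \<open>T\<close>. Hence the covariance with \<open>T\<close> is
  \<open>c\<close> times the number of balls, with \<open>c \<noteq> 0\<close>, and the bound follows from
  \<open>x\<^sup>2 \<ge> 2 c x y - c\<^sup>2 y\<^sup>2\<close>.

  The axioms of a Poisson process concern the counts only. Measurability of the functionals and
  independence of the configuration outside a ball are reduced to finitely many counts by rounding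
  the points to a grid.
\<close>

section \<open>Additive functionals of random geometric graphs\<close>

text \<open>\<open>F_infinite\<close> and \<open>F_bound\<close> serve measurability and
  integrability, \<open>F_iso\<close> the rounding to a grid, \<open>F_union\<close> and
  \<open>F_clique\<close> the splitting at a ball with empty shell. \<open>F_iso\<close> allows two
  radii because rounding comes with an enlarged radius.\<close>

locale rgg_functional =
  fixes F :: "real \<Rightarrow> 'a::euclidean_space set \<Rightarrow> real" and K :: real and g :: "nat \<Rightarrow> real"
  assumes F_infinite: "infinite X \<Longrightarrow> F r X = 0"
    and F_bound: "finite X \<Longrightarrow> \<bar>F r X\<bar> \<le> K * real (card X)"
    and F_iso: "finite X \<Longrightarrow> inj_on h X \<Longrightarrow>
      (\<And>v w. v \<in> X \<Longrightarrow> w \<in> X \<Longrightarrow> norm (h v - h w) \<le> r' \<longleftrightarrow> norm (v - w) \<le> r) \<Longrightarrow> F r' (h ` X) = F r X"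
    and F_union: "finite A \<Longrightarrow> finite B \<Longrightarrow> (\<And>v w. v \<in> A \<Longrightarrow> w \<in> B \<Longrightarrow> norm (v - w) > r) \<Longrightarrow>
      A \<inter> B = {} \<Longrightarrow> F r (A \<union> B) = F r A + F r B"
    and F_clique: "finite X \<Longrightarrow> (\<And>v w. v \<in> X \<Longrightarrow> w \<in> X \<Longrightarrow> norm (v - w) \<le> r) \<Longrightarrow> F r X = g (card X)"

text \<open>Common source of both functionals: degree and component size are invariant under graph
  isomorphisms and ignore points out of reach. Separation is stated for one side only, since the
  norm is symmetric.\<close>

lemma rgg_functional_vertex_sum:
  fixes stat :: "real \<Rightarrow> 'a::euclidean_space set \<Rightarrow> 'a \<Rightarrow> nat" and f :: "nat \<Rightarrow> real"
  assumes bound: "\<And>l. \<bar>f l\<bar> \<le> K"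
    and iso: "\<And>X (h :: 'a \<Rightarrow> 'a) r r' y. inj_on h X \<Longrightarrow>
      (\<And>v w. v \<in> X \<Longrightarrow> w \<in> X \<Longrightarrow> norm (h v - h w) \<le> r' \<longleftrightarrow> norm (v - w) \<le> r) \<Longrightarrow> y \<in> X \<Longrightarrow>
      stat r' (h ` X) (h y) = stat r X y"
    and local: "\<And>A B r y. (\<And>v w. v \<in> A \<Longrightarrow> w \<in> B \<Longrightarrow> norm (v - w) > r) \<Longrightarrow> y \<in> A \<Longrightarrow>
      stat r (A \<union> B) y = stat r A y"
    and clique: "\<And>X r y. finite X \<Longrightarrow> (\<And>v w. v \<in> X \<Longrightarrow> w \<in> X \<Longrightarrow> norm (v - w) \<le> r) \<Longrightarrow> y \<in> X \<Longrightarrow>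
      stat r X y = q (card X)"
  shows "rgg_functional (\<lambda>r X. \<Sum>y\<in>X. f (stat r X y)) K (\<lambda>n. real n * f (q n))"
proof
  fix X :: "'a set" and r
  assume "finite X"
  have "\<bar>\<Sum>y\<in>X. f (stat r X y)\<bar> \<le> (\<Sum>y\<in>X. \<bar>f (stat r X y)\<bar>)" by (rule sum_abs)
  also have "\<dots> \<le> (\<Sum>y\<in>X. K)" by (intro sum_mono bound)
  finally show "\<bar>\<Sum>y\<in>X. f (stat r X y)\<bar> \<le> K * real (card X)" by (simp add: mult.commute)
next
  fix X :: "'a set" and h :: "'a \<Rightarrow> 'a" and r r'
  assume "inj_on h X"
    and "\<And>v w. v \<in> X \<Longrightarrow> w \<in> X \<Longrightarrow> norm (h v - h w) \<le> r' \<longleftrightarrow> norm (v - w) \<le> r"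
  then show "(\<Sum>y\<in>h ` X. f (stat r' (h ` X) y)) = (\<Sum>y\<in>X. f (stat r X y))"
    using iso[of h X r' r] by (simp add: sum.reindex)
next
  fix A B :: "'a set" and r
  assume fin: "finite A" "finite B" and dj: "A \<inter> B = {}"
    and sep: "\<And>v w. v \<in> A \<Longrightarrow> w \<in> B \<Longrightarrow> norm (v - w) > r"
  have "stat r (A \<union> B) y = stat r A y" if "y \<in> A" for y using local[of A B r y] sep that by blast
  moreover have "stat r (A \<union> B) y = stat r B y" if "y \<in> B" for y
    using local[of B A r y] sep that by (metis Un_commute norm_minus_commute)
  ultimately show "(\<Sum>y\<in>A \<union> B. f (stat r (A \<union> B) y)) = (\<Sum>y\<in>A. f (stat r A y)) + (\<Sum>y\<in>B. f (stat r B y))"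
    by (subst sum.union_disjoint[OF fin dj]) simp
next
  fix X :: "'a set" and r
  assume "finite X" "\<And>v w. v \<in> X \<Longrightarrow> w \<in> X \<Longrightarrow> norm (v - w) \<le> r"
  then have "stat r X y = q (card X)" if "y \<in> X" for y using clique that by blast
  then show "(\<Sum>y\<in>X. f (stat r X y)) = real (card X) * f (q (card X))" by simp
\<comment> \<open>The remaining clause \<open>F_infinite\<close> is the convention for sums over
  infinite sets.\<close>
qed auto

section \<open>Degrees: isomorphism, separation, cliques\<close>

lemma rgg_degree_iso:
  assumes inj: "inj_on h X" and "y \<in> X"
    and iso: "\<And>v w. v \<in> X \<Longrightarrow> w \<in> X \<Longrightarrow> norm (h v - h w) \<le> r' \<longleftrightarrow> norm (v - w) \<le> r"
  shows "rgg_degree r' (h ` X) (h y) = rgg_degree r X y"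
proof -
  have *: "h y = h z \<longleftrightarrow> y = z" if "z \<in> X" for z using inj_onD[OF inj] \<open>y \<in> X\<close> that by blast
  have "rgg_edges r' (h ` X) `` {h y} = h ` {z \<in> X. h y \<noteq> h z \<and> norm (h y - h z) \<le> r'}"
    using \<open>y \<in> X\<close> by (auto simp: rgg_edges_def)
  also have "{z \<in> X. h y \<noteq> h z \<and> norm (h y - h z) \<le> r'} = rgg_edges r X `` {y}"
    using \<open>y \<in> X\<close> iso[OF \<open>y \<in> X\<close>] * by (simp add: rgg_edges_def Image_def cong: conj_cong)
  finally have "rgg_edges r' (h ` X) `` {h y} = h ` (rgg_edges r X `` {y})" .
  moreover have "inj_on h (rgg_edges r X `` {y})"
    by (rule inj_on_subset[OF inj]) (auto simp: rgg_edges_def)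
  ultimately show ?thesis by (simp add: rgg_degree_def card_image)
qed

lemma rgg_edges_separated:
  assumes "\<And>v w. v \<in> A \<Longrightarrow> w \<in> B \<Longrightarrow> norm (v - w) > r" "y \<in> A"
  shows "(y, z) \<in> rgg_edges r (A \<union> B) \<longleftrightarrow> (y, z) \<in> rgg_edges r A"
  using assms(1)[OF assms(2), of z] assms(2) by (auto simp: rgg_edges_def)

lemma rgg_degree_separated:
  assumes "\<And>v w. v \<in> A \<Longrightarrow> w \<in> B \<Longrightarrow> norm (v - w) > r" "y \<in> A"
  shows "rgg_degree r (A \<union> B) y = rgg_degree r A y"
proof -
  have "rgg_edges r (A \<union> B) `` {y} = rgg_edges r A `` {y}"
    using rgg_edges_separated[OF assms(1) assms(2)] by auto
  then show ?thesis by (simp add: rgg_degree_def)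
qed

lemma rgg_degree_clique:
  assumes "\<And>v w. v \<in> X \<Longrightarrow> w \<in> X \<Longrightarrow> norm (v - w) \<le> r" "y \<in> X"
  shows "rgg_degree r X y = card X - 1"
proof -
  have "rgg_edges r X `` {y} = X - {y}" using assms by (auto simp: rgg_edges_def)
  then show ?thesis using assms by (simp add: rgg_degree_def)
qed

section \<open>Connected components: isomorphism, separation, cliques\<close>

lemma rgg_component_subset: "y \<in> X \<Longrightarrow> rgg_component r X y \<subseteq> X"
proof
  fix z assume "y \<in> X" "z \<in> rgg_component r X y"
  then have "(y, z) \<in> (rgg_edges r X)\<^sup>*" by (simp add: rgg_component_def)
  then show "z \<in> X" using \<open>y \<in> X\<close> by induction (auto simp: rgg_edges_def)
qed

text \<open>Paths are transported both ways by induction. Pulling back uses that every vertex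
  reached so far has a preimage in \<open>X\<close>; pushing forward uses injectivity to keep the
  endpoints of an edge distinct.\<close>

lemma rgg_component_iso:
  assumes inj: "inj_on h X" and y: "y \<in> X"
    and iso: "\<And>v w. v \<in> X \<Longrightarrow> w \<in> X \<Longrightarrow> norm (h v - h w) \<le> r' \<longleftrightarrow> norm (v - w) \<le> r"
  shows "rgg_component r' (h ` X) (h y) = h ` rgg_component r X y"
proof (intro equalityI subsetI)
  fix z assume "z \<in> rgg_component r' (h ` X) (h y)"
  then have "(h y, z) \<in> (rgg_edges r' (h ` X))\<^sup>*" by (simp add: rgg_component_def)
  then show "z \<in> h ` rgg_component r X y"
  proof induction
    case base
    then show ?case by (auto simp: rgg_component_def)
  next
    case (step u z)
    then obtain u' where u': "u = h u'" "u' \<in> rgg_component r X y" by auto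
    with y have "u' \<in> X" using rgg_component_subset by blast
    moreover obtain z' where "z = h z'" "z' \<in> X" using step by (auto simp: rgg_edges_def)
    ultimately have "(u', z') \<in> rgg_edges r X" using step u' iso by (auto simp: rgg_edges_def)
    with u' \<open>z = h z'\<close> show ?case by (auto simp: rgg_component_def intro: rtrancl_into_rtrancl)
  qed
next
  fix z assume "z \<in> h ` rgg_component r X y"
  then obtain z' where z': "z = h z'" "(y, z') \<in> (rgg_edges r X)\<^sup>*" by (auto simp: rgg_component_def)
  from z'(2) have "(h y, h z') \<in> (rgg_edges r' (h ` X))\<^sup>*"
  proof induction
    case (step u z)
    then have "u \<in> X" "z \<in> X" "u \<noteq> z" "norm (u - z) \<le> r" by (auto simp: rgg_edges_def)
    then have "(h u, h z) \<in> rgg_edges r' (h ` X)"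
      using iso inj_onD[OF inj, of u z] by (auto simp: rgg_edges_def)
    with step show ?case by (auto intro: rtrancl_into_rtrancl)
  qed simp
  with z' show "z \<in> rgg_component r' (h ` X) (h y)" by (simp add: rgg_component_def)
qed

text \<open>A path starting in \<open>A\<close> never leaves \<open>A\<close>, because no edge leads
  from \<open>A\<close> to \<open>B\<close>.\<close>

lemma rgg_component_separated:
  assumes sep: "\<And>v w. v \<in> A \<Longrightarrow> w \<in> B \<Longrightarrow> norm (v - w) > r" and y: "y \<in> A"
  shows "rgg_component r (A \<union> B) y = rgg_component r A y"
proof (intro equalityI subsetI)
  fix z assume "z \<in> rgg_component r (A \<union> B) y"
  then have "(y, z) \<in> (rgg_edges r (A \<union> B))\<^sup>*" by (simp add: rgg_component_def)
  then show "z \<in> rgg_component r A y"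
  proof induction
    case (step u z)
    then have "u \<in> A" using rgg_component_subset[OF y] by blast
    then have "(u, z) \<in> rgg_edges r A" using step rgg_edges_separated[OF sep] by blast
    with step show ?case by (auto simp: rgg_component_def intro: rtrancl_into_rtrancl)
  qed (simp add: rgg_component_def)
next
  have "rgg_edges r A \<subseteq> rgg_edges r (A \<union> B)" by (auto simp: rgg_edges_def)
  then show "z \<in> rgg_component r (A \<union> B) y" if "z \<in> rgg_component r A y" for z
    using that rtrancl_mono[of "rgg_edges r A"] by (auto simp: rgg_component_def)
qed

lemma rgg_component_clique:
  assumes "\<And>v w. v \<in> X \<Longrightarrow> w \<in> X \<Longrightarrow> norm (v - w) \<le> r" "y \<in> X"
  shows "rgg_component r X y = X"
proof (intro equalityI subsetI)
  fix z assume "z \<in> X"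
  then have "z = y \<or> (y, z) \<in> rgg_edges r X" using assms by (auto simp: rgg_edges_def)
  then show "z \<in> rgg_component r X y" by (auto simp: rgg_component_def)
qed (use rgg_component_subset assms in blast)

section \<open>The two instances\<close>

text \<open>In a clique of \<open>n\<close> points all degrees are \<open>n - 1\<close>. At
  \<open>n = 0\<close> the truncated subtraction is harmless, since the factor \<open>real n\<close>
  vanishes.\<close>

lemma rgg_functional_degree:
  assumes "\<And>l. \<bar>f l\<bar> \<le> K"
  shows "rgg_functional (\<lambda>r (X :: 'a::euclidean_space set). \<Sum>y\<in>X. f (rgg_degree r X y)) K
    (\<lambda>n. real n * f (n - 1))"
proof (rule rgg_functional_vertex_sum[OF assms])
  show "rgg_degree r' (h ` X) (h y) = rgg_degree r X y"
    if "inj_on h X" "\<And>v w. v \<in> X \<Longrightarrow> w \<in> X \<Longrightarrow> norm (h v - h w) \<le> r' \<longleftrightarrow> norm (v - w) \<le> r" "y \<in> X"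
    for X :: "'a set" and h :: "'a \<Rightarrow> 'a" and r r' y
    using rgg_degree_iso[OF that(1,3,2)] .
next
  show "rgg_degree r (A \<union> B) y = rgg_degree r A y"
    if "\<And>v w. v \<in> A \<Longrightarrow> w \<in> B \<Longrightarrow> norm (v - w) > r" "y \<in> A" for A B :: "'a set" and r y
    using rgg_degree_separated[OF that] .
next
  show "rgg_degree r X y = card X - 1"
    if "\<And>v w. v \<in> X \<Longrightarrow> w \<in> X \<Longrightarrow> norm (v - w) \<le> r" "y \<in> X" for X :: "'a set" and r y
    using rgg_degree_clique[OF that] .
qed

lemma rgg_functional_component:
  assumes "\<And>l. \<bar>f l\<bar> \<le> K"
  shows "rgg_functional (\<lambda>r (X :: 'a::euclidean_space set). \<Sum>y\<in>X. f (card (rgg_component r X y))) K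
    (\<lambda>n. real n * f n)"
proof (rule rgg_functional_vertex_sum[OF assms])
  fix X :: "'a set" and h :: "'a \<Rightarrow> 'a" and r r' y
  assume *: "inj_on h X" "\<And>v w. v \<in> X \<Longrightarrow> w \<in> X \<Longrightarrow> norm (h v - h w) \<le> r' \<longleftrightarrow> norm (v - w) \<le> r" "y \<in> X"
  have "inj_on h (rgg_component r X y)" by (rule inj_on_subset[OF *(1) rgg_component_subset[OF *(3)]])
  then show "card (rgg_component r' (h ` X) (h y)) = card (rgg_component r X y)"
    using rgg_component_iso[OF *(1,3,2)] by (simp add: card_image)
next
  show "card (rgg_component r (A \<union> B) y) = card (rgg_component r A y)"
    if "\<And>v w. v \<in> A \<Longrightarrow> w \<in> B \<Longrightarrow> norm (v - w) > r" "y \<in> A" for A B :: "'a set" and r y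
    using rgg_component_separated[OF that] by simp
next
  show "card (rgg_component r X y) = card X"
    if "\<And>v w. v \<in> X \<Longrightarrow> w \<in> X \<Longrightarrow> norm (v - w) \<le> r" "y \<in> X" for X :: "'a set" and r y
    using rgg_component_clique[OF that] by simp
qed

section \<open>Counts of a Poisson process\<close>

text \<open>For infinite \<open>X\<close> both sides are 0 by convention. This carries measurability
  over from the counts to cardinalities.\<close>

lemma of_nat_card_eq_enn2real: "real (card X) = enn2real (emeasure (count_space UNIV) X)"
  by (cases "finite X") (simp_all add: emeasure_count_space ennreal_of_nat_eq_real_of_nat)

lemma point_count_eq_0_iff: "point_count X B = 0 \<longleftrightarrow> X \<inter> B = {}"
  by (simp add: emeasure_count_space_eq_0)

lemma finite_iff_point_count: "finite (X \<inter> B) \<longleftrightarrow> point_count X B < \<infinity>"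
  by (simp add: emeasure_count_space of_nat_less_top)

context poisson_process
begin

lemma count_measurable [measurable (raw)]:
  "B \<in> sets \<mu> \<Longrightarrow> (\<lambda>\<omega>. point_count (\<eta> \<omega>) B) \<in> borel_measurable M"
  by (rule measurable_count)

text \<open>The Poisson weights sum to 1, so no mass is left for the value
  \<open>\<infinity>\<close>.\<close>

lemma AE_finite_count:
  assumes B: "B \<in> sets \<mu>" "emeasure \<mu> B < \<infinity>"
  shows "AE \<omega> in M. finite (\<eta> \<omega> \<inter> B)"
proof -
  define E where "E k = {\<omega> \<in> space M. point_count (\<eta> \<omega>) B = of_nat k}" for k :: nat
  note [measurable] = B(1)
  have E: "E k \<in> events" for k unfolding E_def by measurable
  have "(\<lambda>k. measure M (E k)) sums measure M (\<Union>k. E k)"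
    by (rule finite_measure_UNION) (use E in \<open>auto simp: E_def disjoint_family_on_def\<close>)
  moreover have "(\<lambda>k. measure M (E k)) sums (exp (measure \<mu> B) * exp (- measure \<mu> B))"
    unfolding E_def poisson_count[OF B]
    using sums_mult2[OF exp_converges[of "measure \<mu> B"]]
    by (simp add: divide_inverse_commute)
  ultimately have "prob (\<Union>k. E k) = 1"
    by (simp add: sums_iff flip: exp_add)
  then have "AE \<omega> in M. \<omega> \<in> (\<Union>k. E k)" by (rule AE_prob_1)
  then show ?thesis
  proof eventually_elim
    case (elim \<omega>)
    then obtain k where "point_count (\<eta> \<omega>) B = of_nat k" by (auto simp: E_def)
    then show ?case unfolding finite_iff_point_count using of_nat_less_top[of k] by simp
  qed
qed

lemma card_measurable:
  "B \<in> sets \<mu> \<Longrightarrow> (\<lambda>\<omega>. real (card (\<eta> \<omega> \<inter> B))) \<in> borel_measurable M"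
  unfolding of_nat_card_eq_enn2real by measurable

text \<open>The crude estimate \<open>k^2 \<le> 4 ^ k\<close> dominates the series of the second
  moment by an exponential series in \<open>4 * a\<close>.\<close>

lemma integrable_card_square:
  assumes B: "B \<in> sets \<mu>" "emeasure \<mu> B < \<infinity>"
  shows "integrable M (\<lambda>\<omega>. (real (card (\<eta> \<omega> \<inter> B)))\<^sup>2)"
proof (rule integrableI_bounded)
  define a where "a = measure \<mu> B"
  define E where "E k = {\<omega> \<in> space M. point_count (\<eta> \<omega>) B = of_nat k}" for k :: nat
  note [measurable] = B(1) card_measurable[OF B(1)]
  have E [measurable]: "E k \<in> events" for k unfolding E_def by measurable
  show "(\<lambda>\<omega>. (real (card (\<eta> \<omega> \<inter> B)))\<^sup>2) \<in> borel_measurable M" by measurable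
  \<comment> \<open>On infinite configurations the left side is 0 by the convention for
    \<open>card\<close>, so the events \<open>E k\<close> suffice.\<close>
  have le: "ennreal (norm ((real (card (\<eta> \<omega> \<inter> B)))\<^sup>2)) \<le> (\<Sum>k. ennreal ((real k)\<^sup>2) * indicator (E k) \<omega>)"
    (is "?l \<le> suminf ?f") if "\<omega> \<in> space M" for \<omega>
  proof (cases "finite (\<eta> \<omega> \<inter> B)")
    case True
    then have "\<omega> \<in> E (card (\<eta> \<omega> \<inter> B))" using that by (simp add: E_def emeasure_count_space)
    then have "?l = sum ?f {card (\<eta> \<omega> \<inter> B)}" by simp
    also have "\<dots> \<le> suminf ?f" by (rule sum_le_suminf) auto
    finally show ?thesis .
  qed simp
  have "(\<integral>\<^sup>+\<omega>. ennreal (norm ((real (card (\<eta> \<omega> \<inter> B)))\<^sup>2)) \<partial>M)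
    \<le> (\<integral>\<^sup>+\<omega>. (\<Sum>k. ennreal ((real k)\<^sup>2) * indicator (E k) \<omega>) \<partial>M)"
    by (rule nn_integral_mono[OF le])
  also have "\<dots> = (\<Sum>k. ennreal ((real k)\<^sup>2 * measure M (E k)))"
    by (simp add: nn_integral_suminf nn_integral_cmult emeasure_eq_measure ennreal_mult)
  also have "\<dots> < \<infinity>"
  proof -
    have "summable (\<lambda>k. (real k)\<^sup>2 * measure M (E k))"
    proof (rule summable_comparison_test')
      show "summable (\<lambda>k. (inverse (fact k) * (4 * a) ^ k) * exp (- a))"
        by (intro summable_mult2 summable_exp)
      fix k :: nat
      have "real k \<le> 2 ^ k" using of_nat_less_two_power[of k] by (meson less_imp_le)
      then have "(real k)\<^sup>2 \<le> (2 ^ k)\<^sup>2" by (rule power_mono) simp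
      also have "(2 ^ k)\<^sup>2 = (4 ^ k :: real)" by (simp add: power2_eq_square flip: power_mult_distrib)
      finally have "(real k)\<^sup>2 * measure M (E k) \<le> 4 ^ k * measure M (E k)"
        by (rule mult_right_mono) simp
      also have "\<dots> = (inverse (fact k) * (4 * a) ^ k) * exp (- a)"
        unfolding E_def poisson_count[OF B] by (simp add: power_mult_distrib a_def field_simps)
      finally show "norm ((real k)\<^sup>2 * measure M (E k)) \<le> (inverse (fact k) * (4 * a) ^ k) * exp (- a)"
        by simp
    qed
    then show ?thesis by (simp add: less_top ennreal_suminf_neq_top)
  qed
  finally show "(\<integral>\<^sup>+\<omega>. ennreal (norm ((real (card (\<eta> \<omega> \<inter> B)))\<^sup>2)) \<partial>M) < \<infinity>" .
qed

section \<open>Product formulas for counts in disjoint sets\<close>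

text \<open>Borel functions of the independent counts are again independent; the bound 1 provides
  integrability of the factors.\<close>

lemma expectation_prod_counts:
  fixes B :: "nat \<Rightarrow> 'a set" and f :: "nat \<Rightarrow> ennreal \<Rightarrow> real"
  assumes B: "\<And>i. i < m \<Longrightarrow> B i \<in> sets \<mu>" "disjoint_family_on B {..<m}"
    and f: "\<And>i. i < m \<Longrightarrow> f i \<in> borel_measurable borel" "\<And>i x. i < m \<Longrightarrow> \<bar>f i x\<bar> \<le> 1"
  shows "expectation (\<lambda>\<omega>. \<Prod>i<m. f i (point_count (\<eta> \<omega>) (B i))) =
    (\<Prod>i<m. expectation (\<lambda>\<omega>. f i (point_count (\<eta> \<omega>) (B i))))"
proof (rule indep_vars_lebesgue_integral)
  show "indep_vars (\<lambda>_. borel) (\<lambda>i \<omega>. f i (point_count (\<eta> \<omega>) (B i))) {..<m}"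
    by (rule indep_vars_compose2[OF indep_counts[OF B]]) (use f in auto)
  fix i assume "i \<in> {..<m}"
  then have [measurable]: "f i \<in> borel_measurable borel" "B i \<in> sets \<mu>" using B f by auto
  show "integrable M (\<lambda>\<omega>. f i (point_count (\<eta> \<omega>) (B i)))"
    by (rule integrable_const_bound[where B = 1]) (use f \<open>i \<in> _\<close> in auto)
qed simp

lemma expectation_count_eq:
  assumes "B \<in> sets \<mu>" "emeasure \<mu> B < \<infinity>"
  shows "expectation (\<lambda>\<omega>. of_bool (point_count (\<eta> \<omega>) B = of_nat n)) =
    measure \<mu> B ^ n / fact n * exp (- measure \<mu> B)"
proof -
  define E where "E = {\<omega> \<in> space M. point_count (\<eta> \<omega>) B = of_nat n}"
  have [measurable]: "B \<in> sets \<mu>" by fact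
  have E: "E \<in> events" unfolding E_def by measurable
  have "expectation (\<lambda>\<omega>. of_bool (point_count (\<eta> \<omega>) B = of_nat n)) = expectation (indicat_real E)"
    by (rule Bochner_Integration.integral_cong) (auto simp: E_def)
  also have "\<dots> = prob E" using E by simp
  also have "\<dots> = measure \<mu> B ^ n / fact n * exp (- measure \<mu> B)"
    unfolding E_def by (rule poisson_count[OF assms])
  finally show ?thesis .
qed

lemma expectation_mult2_counts:
  fixes f1 f2 :: "ennreal \<Rightarrow> real"
  assumes B: "{B1, B2} \<subseteq> sets \<mu>" "B1 \<inter> B2 = {}"
    and f: "\<And>f. f \<in> {f1, f2} \<Longrightarrow> f \<in> borel_measurable borel" "\<And>f x. f \<in> {f1, f2} \<Longrightarrow> \<bar>f x\<bar> \<le> 1"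
  shows "expectation (\<lambda>\<omega>. f1 (point_count (\<eta> \<omega>) B1) * f2 (point_count (\<eta> \<omega>) B2)) =
    expectation (\<lambda>\<omega>. f1 (point_count (\<eta> \<omega>) B1)) * expectation (\<lambda>\<omega>. f2 (point_count (\<eta> \<omega>) B2))"
proof -
  define C where "C = case_nat B1 (\<lambda>_. B2)"
  define h where "h = case_nat f1 (\<lambda>_. f2)"
  have "expectation (\<lambda>\<omega>. \<Prod>i<Suc (Suc 0). h i (point_count (\<eta> \<omega>) (C i))) =
    (\<Prod>i<Suc (Suc 0). expectation (\<lambda>\<omega>. h i (point_count (\<eta> \<omega>) (C i))))"
  proof (rule expectation_prod_counts)
    show "disjoint_family_on C {..<Suc (Suc 0)}"
      using B by (auto simp: disjoint_family_on_def disjoint_iff C_def less_Suc_eq)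
  qed (use B f in \<open>auto simp: C_def h_def less_Suc_eq\<close>)
  then show ?thesis by (simp add: C_def h_def)
qed

text \<open>The disjointness hypotheses fit the cores and shells of two disjoint balls; this case
  shows that the test variables of different balls are uncorrelated.\<close>

lemma expectation_mult4_counts:
  fixes f1 f2 f3 f4 :: "ennreal \<Rightarrow> real"
  assumes B: "{B1, B2, B3, B4} \<subseteq> sets \<mu>" "B1 \<inter> B2 = {}" "B3 \<inter> B4 = {}" "(B1 \<union> B2) \<inter> (B3 \<union> B4) = {}"
    and f: "\<And>f. f \<in> {f1, f2, f3, f4} \<Longrightarrow> f \<in> borel_measurable borel"
      "\<And>f x. f \<in> {f1, f2, f3, f4} \<Longrightarrow> \<bar>f x\<bar> \<le> 1"
  shows "expectation (\<lambda>\<omega>. (f1 (point_count (\<eta> \<omega>) B1) * f2 (point_count (\<eta> \<omega>) B2)) *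
      (f3 (point_count (\<eta> \<omega>) B3) * f4 (point_count (\<eta> \<omega>) B4))) =
    (expectation (\<lambda>\<omega>. f1 (point_count (\<eta> \<omega>) B1)) * expectation (\<lambda>\<omega>. f2 (point_count (\<eta> \<omega>) B2))) *
    (expectation (\<lambda>\<omega>. f3 (point_count (\<eta> \<omega>) B3)) * expectation (\<lambda>\<omega>. f4 (point_count (\<eta> \<omega>) B4)))"
proof -
  let ?n = "Suc (Suc (Suc (Suc 0)))"
  define C where "C = case_nat B1 (case_nat B2 (case_nat B3 (\<lambda>_. B4)))"
  define h where "h = case_nat f1 (case_nat f2 (case_nat f3 (\<lambda>_. f4)))"
  have "expectation (\<lambda>\<omega>. \<Prod>i<?n. h i (point_count (\<eta> \<omega>) (C i))) =
    (\<Prod>i<?n. expectation (\<lambda>\<omega>. h i (point_count (\<eta> \<omega>) (C i))))"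
  proof (rule expectation_prod_counts)
    show "disjoint_family_on C {..<?n}"
      using B by (auto simp: disjoint_family_on_def disjoint_iff C_def less_Suc_eq)
  qed (use B f in \<open>auto simp: C_def h_def less_Suc_eq\<close>)
  then show ?thesis by (simp add: C_def h_def mult.assoc)
qed

end

section \<open>Discretization\<close>

text \<open>Coordinatewise rounding to the cubic lattice of mesh \<open>1 / Suc n\<close>; the
  successor avoids division by 0.\<close>

definition grid_round :: "nat \<Rightarrow> 'a::euclidean_space \<Rightarrow> 'a" where
  "grid_round n x = (\<Sum>b\<in>Basis. (of_int \<lfloor>real (Suc n) * (x \<bullet> b)\<rfloor> / real (Suc n)) *\<^sub>R b)"

text \<open>The index \<open>n\<close> governs both mesh and window: each level involves finitely
  many cells, and every finite configuration eventually lies in the window. Points sharing a cell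
  merge, so only occupation of cells is recorded.\<close>

definition discretize :: "nat \<Rightarrow> 'a::euclidean_space set \<Rightarrow> 'a set" where
  "discretize n X = grid_round n ` (X \<inter> cball 0 (real n))"

lemma grid_round_measurable [measurable]: "grid_round n \<in> borel_measurable borel"
  unfolding grid_round_def by measurable

lemma norm_grid_round_diff:
  "norm (grid_round n x - x) \<le> real DIM('a) / real (Suc n)" for x :: "'a::euclidean_space"
proof -
  have "\<bar>(grid_round n x - x) \<bullet> b\<bar> \<le> 1 / real (Suc n)" if "b \<in> Basis" for b
  proof -
    define y where "y = real (Suc n) * (x \<bullet> b)"
    have "x \<bullet> b = y / real (Suc n)" by (simp add: y_def)
    then have "(grid_round n x - x) \<bullet> b = (of_int \<lfloor>y\<rfloor> - y) / real (Suc n)"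
      using that by (simp add: grid_round_def inner_diff_left y_def diff_divide_distrib)
    moreover have "\<bar>of_int \<lfloor>y\<rfloor> - y\<bar> \<le> 1" by linarith
    ultimately show ?thesis by (simp add: divide_right_mono)
  qed
  then have "(\<Sum>b\<in>Basis. \<bar>(grid_round n x - x) \<bullet> b\<bar>) \<le> (\<Sum>b\<in>(Basis :: 'a set). 1 / real (Suc n))"
    by (rule sum_mono)
  with norm_le_l1[of "grid_round n x - x"] show ?thesis by simp
qed

lemma finite_grid_round_image: "finite (grid_round n ` cball (0 :: 'a::euclidean_space) R)"
proof -
  \<comment> \<open>The summand 1 covers the loss from rounding down.\<close>
  define m where "m = \<lceil>real (Suc n) * R\<rceil> + 1"
  have "grid_round n ` cball (0 :: 'a) R \<subseteq>
    (\<lambda>f. \<Sum>b\<in>Basis. (of_int (f b) / real (Suc n)) *\<^sub>R b) ` (Basis \<rightarrow>\<^sub>E {- m..m})"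
  proof
    fix y :: 'a assume "y \<in> grid_round n ` cball 0 R"
    then obtain x where x: "y = grid_round n x" "norm x \<le> R" by auto
    define f where "f = (\<lambda>b\<in>Basis. \<lfloor>real (Suc n) * (x \<bullet> b)\<rfloor>)"
    have "f b \<in> {- m..m}" if "b \<in> Basis" for b
    proof -
      have "\<bar>x \<bullet> b\<bar> \<le> R" using Basis_le_norm[OF that, of x] x by linarith
      then have "\<bar>real (Suc n) * (x \<bullet> b)\<bar> \<le> real (Suc n) * R" by (simp add: abs_mult mult_left_mono)
      then show ?thesis unfolding f_def m_def using that by simp linarith
    qed
    then have "f \<in> Basis \<rightarrow>\<^sub>E {- m..m}" by (auto simp: f_def)
    moreover have "y = (\<Sum>b\<in>Basis. (of_int (f b) / real (Suc n)) *\<^sub>R b)"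
      by (simp add: x grid_round_def f_def)
    ultimately show "y \<in> (\<lambda>f. \<Sum>b\<in>Basis. (of_int (f b) / real (Suc n)) *\<^sub>R b) ` (Basis \<rightarrow>\<^sub>E {- m..m})"
      by blast
  qed
  then show ?thesis by (rule finite_subset) (intro finite_imageI finite_PiE, auto)
qed

lemma grid_round_tendsto: "(\<lambda>n. grid_round n x) \<longlonglongrightarrow> x" for x :: "'a::euclidean_space"
proof -
  have "(\<lambda>n. grid_round n x - x) \<longlonglongrightarrow> 0"
  proof (rule Lim_null_comparison)
    show "\<forall>\<^sub>F n in sequentially. norm (grid_round n x - x) \<le> real DIM('a) / real (Suc n)"
      by (intro always_eventually allI norm_grid_round_diff)
    show "(\<lambda>n. real DIM('a) / real (Suc n)) \<longlonglongrightarrow> 0"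
      by (rule LIMSEQ_Suc[OF lim_const_over_n])
  qed
  then show ?thesis using Lim_null by blast
qed

text \<open>
  The slack added to the radius absorbs the rounding error of pairs at distance exactly \<open>r\<close>, so for
  large \<open>n\<close> the discretized configuration carries an isomorphic graph.
\<close>

definition (in rgg_functional) F_grid :: "real \<Rightarrow> nat \<Rightarrow> 'a set \<Rightarrow> real" where
  "F_grid r n X = F (r + 2 * real DIM('a) / real (Suc n)) (discretize n X)"

text \<open>The sequence is even eventually constant: a finite \<open>X\<close> has finitely many
  pairs, and for each of them adjacency and distinctness are eventually respected, so
  \<open>F_iso\<close> applies.\<close>

lemma (in rgg_functional) F_grid_tendsto:
  assumes "finite X"
  shows "(\<lambda>n. F_grid r n X) \<longlonglongrightarrow> F r X"
proof (rule tendsto_eventually)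
  let ?h = grid_round and ?r = "\<lambda>n. r + 2 * real DIM('a) / real (Suc n)"
  have lim: "(\<lambda>n. norm (?h n v - ?h n w)) \<longlonglongrightarrow> norm (v - w)" for v w :: 'a
    by (intro tendsto_norm tendsto_diff grid_round_tendsto)
  have r: "?r \<longlonglongrightarrow> r"
    using tendsto_add[OF tendsto_const LIMSEQ_Suc[OF lim_const_over_n[of "2 * real DIM('a)"]], of r]
    by simp
  have iso: "\<forall>\<^sub>F n in sequentially. norm (?h n v - ?h n w) \<le> ?r n \<longleftrightarrow> norm (v - w) \<le> r" for v w :: 'a
  proof (cases "norm (v - w) \<le> r")
    \<comment> \<open>Adjacent pairs stay adjacent at every level, since the slack is twice the
      rounding error of a single point.\<close>
    case True
    have "norm (?h n v - ?h n w) \<le> ?r n" for n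
    proof -
      have "?h n v - ?h n w = (?h n v - v) - (?h n w - w) + (v - w)" by simp
      then have "norm (?h n v - ?h n w) \<le> norm ((?h n v - v) - (?h n w - w)) + norm (v - w)"
        by (metis norm_triangle_ineq)
      also have "norm ((?h n v - v) - (?h n w - w)) \<le> norm (?h n v - v) + norm (?h n w - w)"
        by (rule norm_triangle_ineq4)
      finally have "norm (?h n v - ?h n w) \<le> norm (?h n v - v) + norm (?h n w - w) + norm (v - w)"
        by simp
      moreover have "2 * real DIM('a) / real (Suc n) = real DIM('a) / real (Suc n) + real DIM('a) / real (Suc n)"
        by (simp only: mult_2 add_divide_distrib)
      ultimately show ?thesis
        using norm_grid_round_diff[of n v] norm_grid_round_diff[of n w] True by linarith
    qed
    with True show ?thesis by simp
  next
    case False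
    \<comment> \<open>For non-adjacent pairs the strict inequality survives, because both the
      rounding error and the slack tend to 0.\<close>
    have "(\<lambda>n. norm (?h n v - ?h n w) - ?r n) \<longlonglongrightarrow> norm (v - w) - r" by (rule tendsto_diff[OF lim r])
    then have "\<forall>\<^sub>F n in sequentially. norm (?h n v - ?h n w) - ?r n > 0"
      by (rule order_tendstoD) (use False in simp)
    then show ?thesis by eventually_elim (use False in auto)
  qed
  have inj: "\<forall>\<^sub>F n in sequentially. ?h n v = ?h n w \<longrightarrow> v = w" for v w :: 'a
  proof (cases "v = w")
    case False
    from lim have "\<forall>\<^sub>F n in sequentially. norm (?h n v - ?h n w) > 0"
      by (rule order_tendstoD) (use False in simp)
    then show ?thesis by eventually_elim auto
  qed simp
  have ball: "\<forall>\<^sub>F n in sequentially. v \<in> cball 0 (real n)" for v :: 'a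
    using eventually_ge_at_top[of "nat \<lceil>norm v\<rceil>"]
    by eventually_elim (simp add: nat_ceiling_le_eq)
  have "\<forall>\<^sub>F n in sequentially. \<forall>v\<in>X. v \<in> cball 0 (real n) \<and> (\<forall>w\<in>X. (?h n v = ?h n w \<longrightarrow> v = w) \<and>
    (norm (?h n v - ?h n w) \<le> ?r n \<longleftrightarrow> norm (v - w) \<le> r))"
    by (intro eventually_ball_finite ballI eventually_conj assms iso inj ball)
  then show "\<forall>\<^sub>F n in sequentially. F_grid r n X = F r X"
  proof eventually_elim
    case (elim n)
    then have "X \<inter> cball 0 (real n) = X" by blast
    moreover have "F (?r n) (?h n ` X) = F r X"
      using elim by (intro F_iso assms inj_onI) auto
    ultimately show ?case by (simp add: F_grid_def discretize_def)
  qed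
qed

text \<open>Merging points only lowers the cardinality. The bound is uniform in \<open>n\<close>, as
  dominated convergence requires; the absolute value of \<open>K\<close> supplies a nonnegative
  factor.\<close>

lemma (in rgg_functional) F_grid_bound:
  assumes "finite X"
  shows "\<bar>F_grid r n X\<bar> \<le> \<bar>K\<bar> * real (card X)"
proof -
  have fin: "finite (discretize n X)" using assms by (simp add: discretize_def)
  have "card (discretize n X) \<le> card X" unfolding discretize_def
    by (rule order_trans[OF card_image_le card_mono]) (use assms in auto)
  then have "\<bar>K\<bar> * real (card (discretize n X)) \<le> \<bar>K\<bar> * real (card X)"
    by (intro mult_left_mono) auto
  moreover have "K * real (card (discretize n X)) \<le> \<bar>K\<bar> * real (card (discretize n X))"
    by (intro mult_right_mono) auto
  ultimately show ?thesis using F_bound[OF fin] unfolding F_grid_def by (meson order_trans)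
qed

section \<open>Reduction to the occupation of finitely many cells\<close>

definition grid_cell :: "nat \<Rightarrow> 'a::euclidean_space \<Rightarrow> 'a set" where
  "grid_cell n c = {x \<in> cball 0 (real n). grid_round n x = c}"

lemma grid_cell_measurable [measurable]: "grid_cell n c \<in> sets borel"
  unfolding grid_cell_def by measurable

text \<open>Summing over all possible values \<open>S\<close> of the discretized set turns an
  arbitrary function of it into a finite combination of products of functions of counts. This is
  what connects functionals of configurations with the axioms on counts.\<close>

lemma discretize_expansion:
  fixes n :: nat and X :: "'a::euclidean_space set" and \<phi> :: "'a set \<Rightarrow> real"
  defines "G \<equiv> grid_round n ` cball (0 :: 'a) (real n)"
  shows "\<phi> (discretize n X) =
    (\<Sum>S\<in>Pow G. \<phi> S * (\<Prod>c\<in>G. of_bool (point_count X (grid_cell n c) \<noteq> 0 \<longleftrightarrow> c \<in> S)))"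
proof -
  have fin: "finite G" unfolding G_def by (rule finite_grid_round_image)
  have D: "discretize n X \<in> Pow G" by (auto simp: discretize_def G_def)
  have occ: "point_count X (grid_cell n c) \<noteq> 0 \<longleftrightarrow> c \<in> discretize n X" for c
    unfolding point_count_eq_0_iff by (auto simp: discretize_def grid_cell_def)
  \<comment> \<open>Agreement of occupation at all grid points of \<open>G\<close> singles out
    \<open>S = discretize n X\<close>.\<close>
  have "(\<Prod>c\<in>G. of_bool (c \<in> discretize n X \<longleftrightarrow> c \<in> S)) = (of_bool (S = discretize n X) :: real)"
    if "S \<in> Pow G" for S
  proof (cases "S = discretize n X")
    case False
    with D that obtain c where "c \<in> G" "\<not> (c \<in> discretize n X \<longleftrightarrow> c \<in> S)" by blast
    then show ?thesis using False fin by (auto intro!: prod_zero)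
  qed simp
  then have "(\<Sum>S\<in>Pow G. \<phi> S * (\<Prod>c\<in>G. of_bool (c \<in> discretize n X \<longleftrightarrow> c \<in> S))) =
    (\<Sum>S\<in>Pow G. \<phi> S * of_bool (S = discretize n X))"
    by (intro sum.cong) auto
  also have "\<dots> = \<phi> (discretize n X)"
    using fin D by (simp add: of_bool_def if_distrib[of "\<lambda>x. _ * x"] sum.delta' cong: if_cong)
  finally show ?thesis unfolding occ by simp
qed

section \<open>Functionals of a Poisson process\<close>

locale rgg_poisson = poisson_process M \<mu> \<eta> + rgg_functional F K g
  for M :: "'w measure" and \<mu> :: "'a::euclidean_space measure" and \<eta>
    and F :: "real \<Rightarrow> 'a set \<Rightarrow> real" and K g +
  assumes sets_intensity: "sets \<mu> = sets borel"
    and finite_intensity: "emeasure \<mu> (space \<mu>) < \<infinity>"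
begin

lemma emeasure_intensity_finite: "emeasure \<mu> B < \<infinity>"
  using finite_intensity emeasure_space[of \<mu> B] by (meson le_less_trans)

lemma AE_finite: "AE \<omega> in M. finite (\<eta> \<omega>)"
  using AE_finite_count[of UNIV] emeasure_intensity_finite by (simp add: sets_intensity)

lemma F_grid_measurable:
  assumes D: "D \<in> sets borel"
  shows "(\<lambda>\<omega>. F_grid r n (\<eta> \<omega> \<inter> D)) \<in> borel_measurable M"
proof -
  have [measurable]: "D \<inter> grid_cell n c \<in> sets \<mu>" for c
    using D by (simp add: sets_intensity)
  show ?thesis
    unfolding F_grid_def
    by (subst discretize_expansion) (unfold Int_assoc, measurable)
qed

lemma F_measurable:
  assumes D: "D \<in> sets borel"
  shows "(\<lambda>\<omega>. F r (\<eta> \<omega> \<inter> D)) \<in> borel_measurable M"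
proof -
  \<comment> \<open>The indicator forces the limit 0 on infinite configurations, where
    \<open>F_grid_tendsto\<close> does not apply, in accordance with
    \<open>F_infinite\<close>.\<close>
  let ?u = "\<lambda>n \<omega>. of_bool (point_count (\<eta> \<omega>) D < \<infinity>) * F_grid r n (\<eta> \<omega> \<inter> D)"
  have "(\<lambda>x. of_bool (x < \<infinity>) :: real) \<in> borel_measurable (borel :: ennreal measure)" by measurable
  moreover have "(\<lambda>\<omega>. point_count (\<eta> \<omega>) D) \<in> borel_measurable M"
    using D by (intro measurable_count) (simp add: sets_intensity)
  ultimately have "(\<lambda>\<omega>. of_bool (point_count (\<eta> \<omega>) D < \<infinity>) :: real) \<in> borel_measurable M"
    by (rule measurable_compose[rotated])
  then have "?u n \<in> borel_measurable M" for n
    by (rule borel_measurable_times[OF _ F_grid_measurable[OF D]])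
  moreover have "(\<lambda>n. ?u n \<omega>) \<longlonglongrightarrow> F r (\<eta> \<omega> \<inter> D)" for \<omega>
  proof (cases "finite (\<eta> \<omega> \<inter> D)")
    case True
    moreover from this have "point_count (\<eta> \<omega>) D < \<infinity>" unfolding finite_iff_point_count .
    ultimately show ?thesis by (simp add: F_grid_tendsto)
  next
    case False
    then have "\<not> point_count (\<eta> \<omega>) D < \<infinity>" unfolding finite_iff_point_count .
    then show ?thesis using False by (simp add: F_infinite)
  qed
  ultimately show ?thesis by (rule borel_measurable_LIMSEQ_real[rotated])
qed

lemma integrable_card: "integrable M (\<lambda>\<omega>. real (card (\<eta> \<omega>)))"
  and integrable_card_power2: "integrable M (\<lambda>\<omega>. (real (card (\<eta> \<omega>)))\<^sup>2)"
proof -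
  have U: "UNIV \<in> sets \<mu>" by (simp add: sets_intensity)
  show sq: "integrable M (\<lambda>\<omega>. (real (card (\<eta> \<omega>)))\<^sup>2)"
    using integrable_card_square[OF U emeasure_intensity_finite] by (simp only: Int_UNIV_right)
  show "integrable M (\<lambda>\<omega>. real (card (\<eta> \<omega>)))"
    by (rule square_integrable_imp_integrable[OF card_measurable[OF U, unfolded Int_UNIV_right] sq])
qed

lemma abs_F_le:
  assumes "finite X" shows "\<bar>F r (X \<inter> D)\<bar> \<le> \<bar>K\<bar> * real (card X)"
proof -
  have "\<bar>F r (X \<inter> D)\<bar> \<le> K * real (card (X \<inter> D))" using assms by (intro F_bound) auto
  also have "\<dots> \<le> \<bar>K\<bar> * real (card X)"
    using assms by (intro mult_mono) (auto intro: card_mono)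
  finally show ?thesis .
qed

lemma F_integrable:
  assumes "D \<in> sets borel"
  shows "integrable M (\<lambda>\<omega>. F r (\<eta> \<omega> \<inter> D))"
proof (rule Bochner_Integration.integrable_bound)
  show "integrable M (\<lambda>\<omega>. \<bar>K\<bar> * real (card (\<eta> \<omega>)))" using integrable_card by simp
  show "AE \<omega> in M. norm (F r (\<eta> \<omega> \<inter> D)) \<le> norm (\<bar>K\<bar> * real (card (\<eta> \<omega>)))"
    using AE_finite by eventually_elim (simp add: abs_F_le abs_mult)
qed (rule F_measurable[OF assms])

text \<open>The variance is a Bochner integral, which would be 0 by convention if the square were
  not integrable, so a lower bound depends on this.\<close>

lemma F_square_integrable: "integrable M (\<lambda>\<omega>. (F r (\<eta> \<omega>))\<^sup>2)"
proof (rule Bochner_Integration.integrable_bound)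
  note [measurable] = F_measurable[of UNIV r, simplified]
  show "(\<lambda>\<omega>. (F r (\<eta> \<omega>))\<^sup>2) \<in> borel_measurable M" by measurable
  show "integrable M (\<lambda>\<omega>. K\<^sup>2 * (real (card (\<eta> \<omega>)))\<^sup>2)"
    by (rule integrable_mult_right[OF integrable_card_power2])
  show "AE \<omega> in M. norm ((F r (\<eta> \<omega>))\<^sup>2) \<le> norm (K\<^sup>2 * (real (card (\<eta> \<omega>)))\<^sup>2)"
    using AE_finite
  proof eventually_elim
    case (elim \<omega>)
    then have "\<bar>F r (\<eta> \<omega>)\<bar>\<^sup>2 \<le> (\<bar>K\<bar> * real (card (\<eta> \<omega>)))\<^sup>2"
      using abs_F_le[of "\<eta> \<omega>" r UNIV] by (intro power_mono) auto
    then show ?case by (simp add: power_mult_distrib)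
  qed
qed

section \<open>Decoupling a ball from the points outside it\<close>

text \<open>After expansion each term is a product of functions of the counts in \<open>C\<close>,
  in \<open>S\<close> and in the grid cells cut down to the complement. These sets are disjoint, so
  the centred factor \<open>v\<close> makes every expectation vanish.\<close>

lemma expectation_F_grid_outside:
  fixes u v :: "ennreal \<Rightarrow> real"
  assumes C: "C \<in> sets borel" "S \<in> sets borel" "C \<inter> S = {}"
    and u: "u \<in> borel_measurable borel" "\<And>x. \<bar>u x\<bar> \<le> 1"
    and v: "v \<in> borel_measurable borel" "\<And>x. \<bar>v x\<bar> \<le> 1"
    and zero: "expectation (\<lambda>\<omega>. v (point_count (\<eta> \<omega>) C)) = 0"
  shows "expectation (\<lambda>\<omega>. v (point_count (\<eta> \<omega>) C) * u (point_count (\<eta> \<omega>) S) *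
    F_grid r n (\<eta> \<omega> \<inter> - (C \<union> S))) = 0"
proof -
  define D where "D = - (C \<union> S)"
  have D: "D \<in> sets borel" using C by (simp add: D_def)
  define G where "G = grid_round n ` cball (0 :: 'a) (real n)"
  have fin: "finite G" unfolding G_def by (rule finite_grid_round_image)
  define w where "w P c x = (of_bool (x \<noteq> 0 \<longleftrightarrow> c \<in> P) :: real)" for P and c :: 'a and x :: ennreal
  define h where "h P \<omega> = v (point_count (\<eta> \<omega>) C) * u (point_count (\<eta> \<omega>) S) *
    (\<Prod>c\<in>G. w P c (point_count (\<eta> \<omega>) (D \<inter> grid_cell n c)))" for P \<omega>
  have [measurable]: "D \<inter> grid_cell n c \<in> sets \<mu>" "C \<in> sets \<mu>" "S \<in> sets \<mu>" for c
    using D C by (simp_all add: sets_intensity)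
  have w [measurable]: "w P c \<in> borel_measurable borel" for P c unfolding w_def by measurable
  note [measurable] = u(1) v(1)
  have h_bound: "\<bar>h P \<omega>\<bar> \<le> 1" for P \<omega>
  proof -
    have "\<bar>\<Prod>c\<in>G. w P c (point_count (\<eta> \<omega>) (D \<inter> grid_cell n c))\<bar> \<le> 1"
      unfolding abs_prod by (rule prod_le_1) (auto simp: w_def)
    then show ?thesis unfolding h_def abs_mult by (intro mult_le_one u v) auto
  qed
  have h_int: "integrable M (h P)" for P
    by (rule integrable_const_bound[where B = 1])
      (use h_bound in \<open>simp, unfold h_def, measurable\<close>)
  have h_zero: "expectation (h P) = 0" for P
  proof -
    \<comment> \<open>Enumerating the cells allows them to be appended to \<open>C\<close> and
      \<open>S\<close> as one family indexed by natural numbers.\<close>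
    obtain e where e: "bij_betw e {..<card G} G"
      using ex_bij_betw_nat_finite[OF fin] by (auto simp: atLeast0LessThan)
    define B where "B = case_nat C (case_nat S (\<lambda>i. D \<inter> grid_cell n (e i)))"
    define f where "f = case_nat v (case_nat u (\<lambda>i. w P (e i)))"
    let ?m = "Suc (Suc (card G))"
    have h: "h P \<omega> = (\<Prod>i<?m. f i (point_count (\<eta> \<omega>) (B i)))" for \<omega>
      unfolding prod.lessThan_Suc_shift h_def B_def f_def
      by (simp add: prod.reindex_bij_betw[OF e, symmetric])
    have inj: "i = i'" if "i < card G" "i' < card G" "e i = e i'" for i i'
      using e that by (auto simp: bij_betw_def dest: inj_onD)
    have "expectation (h P) = (\<Prod>i<?m. expectation (\<lambda>\<omega>. f i (point_count (\<eta> \<omega>) (B i))))"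
      unfolding h
    proof (rule expectation_prod_counts)
      show "B i \<in> sets \<mu>" for i by (auto simp: B_def split: nat.split)
      show "disjoint_family_on B {..<?m}"
        unfolding disjoint_family_on_def B_def using C(3) inj
        by (auto simp: D_def grid_cell_def split: nat.splits)
      show "f i \<in> borel_measurable borel" for i by (auto simp: f_def split: nat.split)
      show "\<bar>f i x\<bar> \<le> 1" for i x using u v by (auto simp: f_def w_def split: nat.split)
    qed
    also have "\<dots> = 0" unfolding prod.lessThan_Suc_shift by (simp add: B_def f_def zero)
    finally show ?thesis .
  qed
  define \<phi> where "\<phi> = F (r + 2 * real DIM('a) / real (Suc n))"
  have "v (point_count (\<eta> \<omega>) C) * u (point_count (\<eta> \<omega>) S) * F_grid r n (\<eta> \<omega> \<inter> D)
    = (\<Sum>P\<in>Pow G. \<phi> P * h P \<omega>)" for \<omega>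
    unfolding F_grid_def \<phi>_def[symmetric] G_def
    by (subst discretize_expansion)
      (simp add: sum_distrib_left h_def w_def G_def Int_assoc mult_ac)
  then have "expectation (\<lambda>\<omega>. v (point_count (\<eta> \<omega>) C) * u (point_count (\<eta> \<omega>) S) * F_grid r n (\<eta> \<omega> \<inter> D))
    = (\<Sum>P\<in>Pow G. \<phi> P * expectation (h P))"
    using h_int by simp
  then show ?thesis by (simp add: h_zero D_def)
qed

text \<open>Passage to the limit in the discretized identity, with a multiple of the number of
  points as integrable majorant.\<close>

lemma expectation_F_outside:
  fixes u v :: "ennreal \<Rightarrow> real"
  assumes C: "C \<in> sets borel" "S \<in> sets borel" "C \<inter> S = {}"
    and u: "u \<in> borel_measurable borel" "\<And>x. \<bar>u x\<bar> \<le> 1"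
    and v: "v \<in> borel_measurable borel" "\<And>x. \<bar>v x\<bar> \<le> 1"
    and zero: "expectation (\<lambda>\<omega>. v (point_count (\<eta> \<omega>) C)) = 0"
  shows "expectation (\<lambda>\<omega>. v (point_count (\<eta> \<omega>) C) * u (point_count (\<eta> \<omega>) S) *
    F r (\<eta> \<omega> \<inter> - (C \<union> S))) = 0"
proof -
  have D: "- (C \<union> S) \<in> sets borel" using C by simp
  have [measurable]: "C \<in> sets \<mu>" "S \<in> sets \<mu>" using C by (simp_all add: sets_intensity)
  note [measurable] = u(1) v(1) F_measurable[OF D] F_grid_measurable[OF D]
  let ?t = "\<lambda>\<omega>. v (point_count (\<eta> \<omega>) C) * u (point_count (\<eta> \<omega>) S)"
  have t: "\<bar>?t \<omega>\<bar> \<le> 1" for \<omega> unfolding abs_mult by (intro mult_le_one u v) auto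
  have "(\<lambda>n. expectation (\<lambda>\<omega>. ?t \<omega> * F_grid r n (\<eta> \<omega> \<inter> - (C \<union> S)))) \<longlonglongrightarrow>
    expectation (\<lambda>\<omega>. ?t \<omega> * F r (\<eta> \<omega> \<inter> - (C \<union> S)))"
  proof (rule integral_dominated_convergence)
    show "integrable M (\<lambda>\<omega>. \<bar>K\<bar> * real (card (\<eta> \<omega>)))" using integrable_card by simp
    show "AE \<omega> in M. (\<lambda>n. ?t \<omega> * F_grid r n (\<eta> \<omega> \<inter> - (C \<union> S))) \<longlonglongrightarrow>
      ?t \<omega> * F r (\<eta> \<omega> \<inter> - (C \<union> S))"
      using AE_finite by eventually_elim (intro tendsto_mult_left F_grid_tendsto, simp)
    show "AE \<omega> in M. norm (?t \<omega> * F_grid r n (\<eta> \<omega> \<inter> - (C \<union> S))) \<le> \<bar>K\<bar> * real (card (\<eta> \<omega>))" for n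
      using AE_finite
    proof eventually_elim
      case (elim \<omega>)
      let ?X = "\<eta> \<omega> \<inter> - (C \<union> S)"
      have "\<bar>F_grid r n ?X\<bar> \<le> \<bar>K\<bar> * real (card ?X)" using elim by (intro F_grid_bound) auto
      also have "\<dots> \<le> \<bar>K\<bar> * real (card (\<eta> \<omega>))"
        using elim by (intro mult_left_mono) (auto intro: card_mono)
      finally show ?case
        using mult_mono[OF t[of \<omega>], of "\<bar>F_grid r n ?X\<bar>"] by (simp add: abs_mult)
    qed
  qed measurable
  then show ?thesis
    unfolding expectation_F_grid_outside[OF C u v zero] by (simp add: LIMSEQ_const_iff)
qed

text \<open>The empty configuration is a clique and has value 0 by \<open>F_bound\<close>. Hence the
  comparison with an empty core adds nothing to the covariance.\<close>

lemma g_0: "g 0 = 0"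
  using F_clique[of "{}" 0] F_bound[of "{}" 0] by simp

text \<open>
  The weights \<open>p0\<close> and \<open>pk\<close> in the definition of \<open>v\<close> below, the probabilities of \<open>0\<close> and \<open>k\<close> points
  in a core, make the test variables \<open>T i\<close> centred.
\<close>

lemma variance_lower_bound:
  fixes C S :: "'i \<Rightarrow> 'a set"
  assumes I: "finite I"
    and meas: "\<And>i. i \<in> I \<Longrightarrow> C i \<in> sets borel" "\<And>i. i \<in> I \<Longrightarrow> S i \<in> sets borel"
    and CS: "\<And>i. i \<in> I \<Longrightarrow> C i \<inter> S i = {}"
    and disj: "disjoint_family_on (\<lambda>i. C i \<union> S i) I"
    and a: "\<And>i. i \<in> I \<Longrightarrow> measure \<mu> (C i) = a" and b: "\<And>i. i \<in> I \<Longrightarrow> measure \<mu> (S i) = b"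
    and close: "\<And>i v w. i \<in> I \<Longrightarrow> v \<in> C i \<Longrightarrow> w \<in> C i \<Longrightarrow> norm (v - w) \<le> r"
    and far: "\<And>i v w. i \<in> I \<Longrightarrow> v \<in> C i \<Longrightarrow> w \<notin> C i \<union> S i \<Longrightarrow> norm (v - w) > r"
  shows "variance (\<lambda>\<omega>. F r (\<eta> \<omega>)) \<ge>
    (g k * (exp (- a) * (a ^ k / fact k * exp (- a)) * exp (- b)))\<^sup>2 * real (card I)"
proof (cases "I = {}")
  case True
  then show ?thesis by simp
next
  case False
  \<comment> \<open>An actual core is needed to see that \<open>a\<close> is nonnegative and that
    \<open>pk\<close> is a probability.\<close>
  then obtain i0 where i0: "i0 \<in> I" by blast
  define p0 pk where "p0 = exp (- a)" and "pk = a ^ k / fact k * exp (- a)"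
  \<comment> \<open>This is the covariance of the functional with each single \<open>T i\<close>, as
    \<open>FT\<close> shows.\<close>
  define c where "c = g k * (p0 * pk * exp (- b))"
  define u :: "ennreal \<Rightarrow> real" where "u x = of_bool (x = 0)" for x
  define wk :: "ennreal \<Rightarrow> real" where "wk x = of_bool (x = of_nat k)" for x
  define v where "v x = p0 * wk x - pk * u x" for x
  define T where "T i \<omega> = v (point_count (\<eta> \<omega>) (C i)) * u (point_count (\<eta> \<omega>) (S i))" for i \<omega>
  have sets: "C i \<in> sets \<mu>" "S i \<in> sets \<mu>" if "i \<in> I" for i
    using meas that by (simp_all add: sets_intensity)
  have E_eq: "expectation (\<lambda>\<omega>. wk (point_count (\<eta> \<omega>) (C i))) = pk"
    "expectation (\<lambda>\<omega>. u (point_count (\<eta> \<omega>) (C i))) = p0"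
    "expectation (\<lambda>\<omega>. u (point_count (\<eta> \<omega>) (S i))) = exp (- b)" if "i \<in> I" for i
    using expectation_count_eq[OF sets(1)[OF that] emeasure_intensity_finite, of k]
      expectation_count_eq[OF sets(1)[OF that] emeasure_intensity_finite, of 0]
      expectation_count_eq[OF sets(2)[OF that] emeasure_intensity_finite, of 0] a[OF that] b[OF that]
    by (simp_all add: u_def wk_def p0_def pk_def)
  have u: "u \<in> borel_measurable borel" "\<bar>u x\<bar> \<le> 1" for x unfolding u_def by simp_all
  have wk: "wk \<in> borel_measurable borel" "\<bar>wk x\<bar> \<le> 1" for x unfolding wk_def by simp_all
  have v_meas: "v \<in> borel_measurable borel" unfolding v_def using u(1) wk(1) by simp
  have "0 \<le> a" using a[OF i0] by auto
  then have p_nonneg: "0 \<le> p0" "0 \<le> pk" by (simp_all add: p0_def pk_def)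
  have p_le: "p0 \<le> 1" "pk \<le> 1"
  proof -
    show "p0 \<le> 1" using \<open>0 \<le> a\<close> by (simp add: p0_def)
    have "pk = prob {\<omega> \<in> space M. point_count (\<eta> \<omega>) (C i0) = of_nat k}"
      using poisson_count[OF sets(1)[OF i0] emeasure_intensity_finite, of k] by (simp add: pk_def a[OF i0])
    then show "pk \<le> 1" by simp
  qed
  have v_bound: "\<bar>v x\<bar> \<le> 1" for x
    using p_nonneg p_le by (auto simp: v_def u_def wk_def)
  have int_count: "integrable M (\<lambda>\<omega>. h (point_count (\<eta> \<omega>) B))"
    if "B \<in> sets \<mu>" "h \<in> borel_measurable borel" "\<And>x. \<bar>h x\<bar> \<le> 1" for B and h :: "ennreal \<Rightarrow> real"
    by (rule integrable_const_bound[where B = 1])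
      (use that measurable_compose[OF measurable_count[OF that(1)] that(2)] in auto)
  have v_zero: "expectation (\<lambda>\<omega>. v (point_count (\<eta> \<omega>) (C i))) = 0" if "i \<in> I" for i
  proof -
    have "expectation (\<lambda>\<omega>. v (point_count (\<eta> \<omega>) (C i))) = p0 * pk - pk * p0"
      unfolding v_def
      by (subst Bochner_Integration.integral_diff)
        (simp_all add: E_eq[OF that] int_count sets[OF that] u wk)
    then show ?thesis by simp
  qed
  have T_meas: "T i \<in> borel_measurable M" if "i \<in> I" for i
    unfolding T_def
    using measurable_compose[OF measurable_count[OF sets(1)[OF that]] v_meas]
      measurable_compose[OF measurable_count[OF sets(2)[OF that]] u(1)]
    by (rule borel_measurable_times)
  have T_bound: "\<bar>T i \<omega>\<bar> \<le> 1" for i \<omega>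
    unfolding T_def abs_mult by (intro mult_le_one v_bound u) auto
  have T_int: "integrable M (T i)" if "i \<in> I" for i
    by (rule integrable_const_bound[where B = 1]) (use T_bound T_meas[OF that] in auto)
  have TT_int: "integrable M (\<lambda>\<omega>. T i \<omega> * T j \<omega>)" if "i \<in> I" "j \<in> I" for i j
    by (rule integrable_const_bound[where B = 1])
      (use T_bound T_meas[OF that(1)] T_meas[OF that(2)] in \<open>auto simp: abs_mult intro!: mult_le_one\<close>)
  have F_int: "integrable M (\<lambda>\<omega>. F r (\<eta> \<omega>))" using F_integrable[of UNIV r] by simp
  have mult_T_int: "integrable M (\<lambda>\<omega>. X \<omega> * T i \<omega>)" if "integrable M X" "i \<in> I" for X i
  proof (rule Bochner_Integration.integrable_bound[OF that(1)])
    show "(\<lambda>\<omega>. X \<omega> * T i \<omega>) \<in> borel_measurable M" using that T_meas by simp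
    show "AE \<omega> in M. norm (X \<omega> * T i \<omega>) \<le> norm (X \<omega>)"
      using T_bound by (auto simp: abs_mult mult_left_le)
  qed
  have T_zero: "expectation (T i) = 0" if "i \<in> I" for i
    unfolding T_def
    by (subst expectation_mult2_counts)
      (use sets[OF that] CS[OF that] u v_bound v_meas v_zero[OF that] in auto)
  have TT_zero: "expectation (\<lambda>\<omega>. T i \<omega> * T j \<omega>) = 0" if "i \<in> I" "j \<in> I" "i \<noteq> j" for i j
    unfolding T_def
    by (subst expectation_mult4_counts)
      (use sets that CS disjoint_family_onD[OF disj that] u v_bound v_meas v_zero in auto)
  have FT: "expectation (\<lambda>\<omega>. F r (\<eta> \<omega>) * T i \<omega>) = c" if i: "i \<in> I" for i
  proof -
    define R where "R \<omega> = \<eta> \<omega> \<inter> - (C i \<union> S i)" for \<omega>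
    have D: "- (C i \<union> S i) \<in> sets borel" using meas i by auto
    let ?q = "\<lambda>\<omega>. wk (point_count (\<eta> \<omega>) (C i)) * u (point_count (\<eta> \<omega>) (S i))"
    \<comment> \<open>If the shell is empty, the functional splits into the core value and the value
      outside; if it is occupied, \<open>u\<close> annihilates all terms.\<close>
    have *: "F r X * (v (point_count X (C i)) * u (point_count X (S i))) =
      g k * p0 * (wk (point_count X (C i)) * u (point_count X (S i))) +
      v (point_count X (C i)) * u (point_count X (S i)) * F r (X \<inter> - (C i \<union> S i))"
      if fin: "finite X" for X
    proof (cases "X \<inter> S i = {}")
      case True
      define n where "n = card (X \<inter> C i)"
      have "F r X = F r (X \<inter> C i \<union> X \<inter> - (C i \<union> S i))"
        using True by (intro arg_cong2[where f = F]) auto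
      also have "\<dots> = F r (X \<inter> C i) + F r (X \<inter> - (C i \<union> S i))"
        using fin far[OF i] by (intro F_union) auto
      also have "F r (X \<inter> C i) = g n"
        using fin close[OF i] unfolding n_def by (intro F_clique) auto
      finally have F: "F r X = g n + F r (X \<inter> - (C i \<union> S i))" .
      have n: "point_count X (C i) = of_nat n" using fin by (simp add: n_def)
      \<comment> \<open>The part of \<open>v\<close> with \<open>u\<close> is nonzero only at
        \<open>n = 0\<close>, where \<open>g\<close> vanishes; for \<open>k = 0\<close> both sides
        are 0.\<close>
      have "g n * v (of_nat n) = g k * p0 * wk (of_nat n)"
        using g_0 by (auto simp: v_def wk_def u_def p0_def pk_def)
      then show ?thesis unfolding F n by (simp add: algebra_simps)
    next
      case False
      then have "u (point_count X (S i)) = 0" by (simp add: u_def point_count_eq_0_iff)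
      then show ?thesis by simp
    qed
    have q_meas: "?q \<in> borel_measurable M"
      using measurable_compose[OF measurable_count[OF sets(1)[OF i]] wk(1)]
        measurable_compose[OF measurable_count[OF sets(2)[OF i]] u(1)]
      by (rule borel_measurable_times)
    have q_int: "integrable M ?q"
      by (rule integrable_const_bound[where B = 1])
        (use q_meas u wk in \<open>auto simp: abs_mult intro!: mult_le_one\<close>)
    have R_int: "integrable M (\<lambda>\<omega>. T i \<omega> * F r (R \<omega>))"
      using mult_T_int[OF F_integrable[OF D] i] by (simp add: R_def mult.commute)
    have "expectation (\<lambda>\<omega>. F r (\<eta> \<omega>) * T i \<omega>) =
      expectation (\<lambda>\<omega>. g k * p0 * ?q \<omega> + T i \<omega> * F r (R \<omega>))"
    proof (rule integral_cong_AE)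
      show "(\<lambda>\<omega>. F r (\<eta> \<omega>) * T i \<omega>) \<in> borel_measurable M"
        using mult_T_int[OF F_int i] by (rule borel_measurable_integrable)
      show "(\<lambda>\<omega>. g k * p0 * ?q \<omega> + T i \<omega> * F r (R \<omega>)) \<in> borel_measurable M"
        using q_int R_int by (intro borel_measurable_integrable) simp
      show "AE \<omega> in M. F r (\<eta> \<omega>) * T i \<omega> = g k * p0 * ?q \<omega> + T i \<omega> * F r (R \<omega>)"
        using AE_finite unfolding T_def R_def by eventually_elim (rule *)
    qed
    also have "\<dots> = g k * p0 * expectation ?q + expectation (\<lambda>\<omega>. T i \<omega> * F r (R \<omega>))"
      using q_int R_int by simp
    also have "expectation (\<lambda>\<omega>. T i \<omega> * F r (R \<omega>)) = 0"
      unfolding T_def R_def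
      by (rule expectation_F_outside)
        (use meas[OF i] CS[OF i] u v_bound v_meas v_zero[OF i] in auto)
    also have "expectation ?q = pk * exp (- b)"
      by (subst expectation_mult2_counts)
        (use sets[OF i] CS[OF i] u wk E_eq[OF i] in auto)
    finally show ?thesis by (simp add: c_def mult_ac)
  qed
  define m where "m = expectation (\<lambda>\<omega>. F r (\<eta> \<omega>))"
  define U where "U \<omega> = (\<Sum>i\<in>I. T i \<omega>)" for \<omega>
  have U2: "(U \<omega>)\<^sup>2 = (\<Sum>i\<in>I. \<Sum>j\<in>I. T i \<omega> * T j \<omega>)" for \<omega>
    by (simp add: U_def power2_eq_square sum_product)
  have U2_int: "integrable M (\<lambda>\<omega>. (U \<omega>)\<^sup>2)" unfolding U2 using TT_int by simp
  have "expectation (\<lambda>\<omega>. (U \<omega>)\<^sup>2) = (\<Sum>i\<in>I. \<Sum>j\<in>I. expectation (\<lambda>\<omega>. T i \<omega> * T j \<omega>))"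
    unfolding U2 using TT_int by (simp add: Bochner_Integration.integral_sum Bochner_Integration.integrable_sum)
  also have "\<dots> = (\<Sum>i\<in>I. expectation (\<lambda>\<omega>. T i \<omega> * T i \<omega>))"
  proof (rule sum.cong[OF refl])
    fix i assume i: "i \<in> I"
    then have "(\<Sum>j\<in>I. expectation (\<lambda>\<omega>. T i \<omega> * T j \<omega>)) = (\<Sum>j\<in>{i}. expectation (\<lambda>\<omega>. T i \<omega> * T j \<omega>))"
      using I TT_zero by (intro sum.mono_neutral_right) auto
    then show "(\<Sum>j\<in>I. expectation (\<lambda>\<omega>. T i \<omega> * T j \<omega>)) = expectation (\<lambda>\<omega>. T i \<omega> * T i \<omega>)" by simp
  qed
  also have "\<dots> \<le> (\<Sum>i\<in>I. 1)"
  proof (rule sum_mono)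
    fix i assume i: "i \<in> I"
    have "T i \<omega> * T i \<omega> \<le> 1" for \<omega>
      using mult_le_one[OF T_bound _ T_bound, of i \<omega> i \<omega>] by simp
    then have "expectation (\<lambda>\<omega>. T i \<omega> * T i \<omega>) \<le> expectation (\<lambda>\<omega>. 1)"
      by (intro integral_mono TT_int i) auto
    then show "expectation (\<lambda>\<omega>. T i \<omega> * T i \<omega>) \<le> 1" by (simp add: prob_space)
  qed
  finally have EU2: "expectation (\<lambda>\<omega>. (U \<omega>)\<^sup>2) \<le> real (card I)" by simp
  have FU: "(F r (\<eta> \<omega>) - m) * U \<omega> = (\<Sum>i\<in>I. F r (\<eta> \<omega>) * T i \<omega> - m * T i \<omega>)" for \<omega>
    by (simp add: U_def sum_distrib_left left_diff_distrib sum_subtractf)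
  have FU_int: "integrable M (\<lambda>\<omega>. (F r (\<eta> \<omega>) - m) * U \<omega>)"
    unfolding FU using mult_T_int[OF F_int] T_int by simp
  have EFU: "expectation (\<lambda>\<omega>. (F r (\<eta> \<omega>) - m) * U \<omega>) = c * real (card I)"
    unfolding FU using mult_T_int[OF F_int] T_int by (simp add: FT T_zero)
  have sq_int: "integrable M (\<lambda>\<omega>. (F r (\<eta> \<omega>) - m)\<^sup>2)"
    unfolding power2_diff using F_square_integrable F_int by simp
  \<comment> \<open>With \<open>N = card I\<close>, the covariance with \<open>U\<close> is
    \<open>c * N\<close> and the second moment of \<open>U\<close> is at most \<open>N\<close>.
    Multiplying \<open>U\<close> by \<open>c\<close> thus leaves
    \<open>2 * c^2 * N - c^2 * N\<close>.\<close>
  have "c\<^sup>2 * real (card I) \<le> 2 * c * (c * real (card I)) - c\<^sup>2 * expectation (\<lambda>\<omega>. (U \<omega>)\<^sup>2)"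
    using mult_left_mono[OF EU2, of "c\<^sup>2"] by (simp add: power2_eq_square)
  also have "\<dots> = expectation (\<lambda>\<omega>. 2 * c * ((F r (\<eta> \<omega>) - m) * U \<omega>) - c\<^sup>2 * (U \<omega>)\<^sup>2)"
    unfolding EFU[symmetric] using FU_int U2_int by simp
  also have "\<dots> \<le> expectation (\<lambda>\<omega>. (F r (\<eta> \<omega>) - m)\<^sup>2)"
  proof (rule integral_mono)
    have "2 * c * (x * y) - c\<^sup>2 * y\<^sup>2 \<le> x\<^sup>2" for x y :: real
      using zero_le_power2[of "x - c * y"] by (simp add: power2_eq_square algebra_simps)
    then show "2 * c * ((F r (\<eta> \<omega>) - m) * U \<omega>) - c\<^sup>2 * (U \<omega>)\<^sup>2 \<le> (F r (\<eta> \<omega>) - m)\<^sup>2" for \<omega> .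
  qed (use FU_int U2_int sq_int in simp_all)
  finally show ?thesis unfolding m_def c_def p0_def pk_def .
qed

end

section \<open>The variance bound\<close>

text \<open>The centres form a cubic grid of spacing \<open>4 * r\<close> starting at
  \<open>z\<close>, with \<open>L\<close> points in each direction. They stay within
  \<open>R / 2\<close> of \<open>z\<close>, and the radius \<open>2 * r\<close> fits into the other
  half.\<close>

lemma ball_packing:
  fixes z :: "'a::euclidean_space"
  assumes r: "r > 0" and R: "16 * real DIM('a) * r \<le> R"
  obtains P where "finite P" "\<And>x. x \<in> P \<Longrightarrow> ball x (2 * r) \<subseteq> ball z R"
    "disjoint_family_on (\<lambda>x. ball x (2 * r)) P"
    "(R / (16 * real DIM('a) * r)) ^ DIM('a) \<le> real (card P)"
proof -
  let ?d = "real DIM('a)"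
  have d: "?d \<ge> 1" using DIM_positive[where 'a = 'a] by linarith
  have dr: "?d * r \<ge> r" using d r by simp
  define t where "t = R / (16 * ?d * r)"
  have t: "t \<ge> 1" "R = 16 * t * (?d * r)" using r R d by (auto simp: t_def)
  \<comment> \<open>Since \<open>t \<ge> 1\<close>, rounding \<open>2 * t\<close> down still leaves
    at least \<open>t\<close>.\<close>
  define L where "L = nat \<lfloor>2 * t\<rfloor>"
  have L: "t \<le> real L" "real L \<le> 2 * t" using t unfolding L_def by linarith+
  define p :: "('a \<Rightarrow> nat) \<Rightarrow> 'a" where "p f = z + (\<Sum>b\<in>Basis. (4 * r * real (f b)) *\<^sub>R b)" for f
  define Q where "Q = ((Basis :: 'a set) \<rightarrow>\<^sub>E {..<L})"
  have p_inner: "(p f - p h) \<bullet> b = 4 * r * (real (f b) - real (h b))" if "b \<in> Basis" for f h b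
    using that by (simp add: p_def inner_diff_left inner_add_left right_diff_distrib)
  have sep: "norm (p f - p h) \<ge> 4 * r" if "f \<in> Q" "h \<in> Q" "f \<noteq> h" for f h
  proof -
    have "\<exists>b\<in>Basis. f b \<noteq> h b"
    proof (rule ccontr)
      assume *: "\<not> (\<exists>b\<in>Basis. f b \<noteq> h b)"
      have "f = h" by (rule PiE_ext[OF that(1,2)[unfolded Q_def]]) (use * in simp)
      with that(3) show False by simp
    qed
    then obtain b where b: "b \<in> Basis" "f b \<noteq> h b" by blast
    then have "1 \<le> \<bar>real (f b) - real (h b)\<bar>" by linarith
    then have "4 * r \<le> \<bar>(p f - p h) \<bullet> b\<bar>" using r unfolding p_inner[OF b(1)] by (simp add: abs_mult)
    also have "\<dots> \<le> norm (p f - p h)" by (rule Basis_le_norm[OF b(1)])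
    finally show ?thesis .
  qed
  have fin: "finite Q" unfolding Q_def by (auto intro: finite_PiE)
  have inj: "inj_on p Q"
    using sep r by (intro inj_onI) (metis diff_self mult_pos_pos norm_zero not_le zero_less_numeral)
  have near: "norm (p f - z) \<le> 8 * t * (?d * r)" if "f \<in> Q" for f
  proof -
    have "\<bar>(p f - z) \<bullet> b\<bar> \<le> 4 * r * (2 * t)" if b: "b \<in> Basis" for b
    proof -
      have "f b < L" using \<open>f \<in> Q\<close> b by (auto simp: Q_def)
      then have "real (f b) \<le> 2 * t" using L by linarith
      then show ?thesis using b r by (simp add: p_def abs_mult)
    qed
    then have "(\<Sum>b\<in>Basis. \<bar>(p f - z) \<bullet> b\<bar>) \<le> (\<Sum>b\<in>(Basis :: 'a set). 4 * r * (2 * t))"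
      by (rule sum_mono)
    then show ?thesis using norm_le_l1[of "p f - z"] by (simp add: mult_ac)
  qed
  show thesis
  proof
    show "finite (p ` Q)" using fin by simp
    show "ball x (2 * r) \<subseteq> ball z R" if "x \<in> p ` Q" for x
    proof
      fix y assume y: "y \<in> ball x (2 * r)"
      obtain f where f: "f \<in> Q" "x = p f" using \<open>x \<in> p ` Q\<close> by blast
      have "dist z y \<le> dist x z + dist x y" by (metis dist_commute dist_triangle)
      also have "\<dots> < 8 * t * (?d * r) + 2 * r" using near[OF f(1)] y by (simp add: f(2) dist_norm)
      also have "\<dots> \<le> R"
      proof -
        have "1 * (?d * r) \<le> t * (?d * r)" using t dr r by (intro mult_right_mono) auto
        then have "r \<le> t * (?d * r)" using dr by linarith
        then show ?thesis using r unfolding t(2) by linarith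
      qed
      finally show "y \<in> ball z R" by simp
    qed
    show "disjoint_family_on (\<lambda>x. ball x (2 * r)) (p ` Q)"
      unfolding disjoint_family_on_def
    proof (intro ballI impI)
      fix x y assume "x \<in> p ` Q" "y \<in> p ` Q" "x \<noteq> y"
      then have "dist x y \<ge> 2 * r + 2 * r" using sep by (fastforce simp: dist_norm)
      then show "ball x (2 * r) \<inter> ball y (2 * r) = {}" by (intro disjoint_ballI)
    qed
    have "card (p ` Q) = L ^ DIM('a)" by (simp add: card_image[OF inj]) (simp add: Q_def card_PiE)
    then show "(R / (16 * ?d * r)) ^ DIM('a) \<le> real (card (p ` Q))"
      unfolding t_def[symmetric] using L t by (auto intro: power_mono)
  qed
qed

text \<open>In this scaling \<open>s * r s ^ d\<close> is the constant \<open>\<rho> ^ d\<close>.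
  Cores and shells inside \<open>W\<close> therefore have masses independent of \<open>s\<close>,
  while the number of packed balls is at least a fixed multiple of \<open>s\<close>.\<close>

lemma rgg_functional_variance:
  fixes W :: "'a::euclidean_space set"
    and M :: "real \<Rightarrow> 'w measure"
    and \<eta> :: "real \<Rightarrow> 'w \<Rightarrow> 'a set"
    and \<rho> :: real and r :: "real \<Rightarrow> real"
  assumes F: "rgg_functional F K g" and gk: "g k \<noteq> 0"
    and W: "compact W" "convex W" "emeasure lborel W > 0"
    and \<eta>: "\<And>s. s \<ge> 1 \<Longrightarrow>
      poisson_process (M s) (scale_measure (ennreal s) (density lborel (indicator W))) (\<eta> s)"
    and \<rho>: "\<rho> > 0"
    and r: "\<And>s. s \<ge> 1 \<Longrightarrow> r s = \<rho> * s powr (- 1 / real DIM('a))"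
  shows "\<exists>c>0. \<forall>\<^sub>F s in at_top.
    prob_space.variance (M s) (\<lambda>\<omega>. F (r s) (\<eta> s \<omega>)) \<ge> c * s"
proof -
  let ?d = "DIM('a)"
  have Wb: "W \<in> sets borel" using W(1) by (simp add: borel_closed compact_imp_closed)
  \<comment> \<open>A convex set with empty interior is negligible, contrary to the positive
    volume.\<close>
  have "interior W \<noteq> {}"
  proof
    assume "interior W = {}"
    then have "negligible W" using negligible_convex_interior W(2) by blast
    then have "emeasure lebesgue W = 0" by (simp add: negligible_iff_emeasure0 Wb)
    then show False using W(3) Wb by (simp add: emeasure_completion)
  qed
  then obtain z where "z \<in> interior W" by blast
  then obtain R where R: "R > 0" "ball z R \<subseteq> W" by (meson mem_interior)
  \<comment> \<open>\<open>\<kappa>\<close> is the intensity mass of a ball of radius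
    \<open>r s\<close> inside \<open>W\<close>; \<open>a\<close> belongs to the core of half that
    radius, \<open>b\<close> to the shell reaching out to twice that radius.\<close>
  define \<kappa> where "\<kappa> = unit_ball_vol (real ?d) * \<rho> ^ ?d"
  have \<kappa>: "\<kappa> > 0" using \<rho> by (simp add: \<kappa>_def)
  define a b where "a = \<kappa> * (1/2) ^ ?d" and "b = \<kappa> * 2 ^ ?d - a"
  define q where "q = (g k * (exp (- a) * (a ^ k / fact k * exp (- a)) * exp (- b)))\<^sup>2"
  \<comment> \<open>The factor after \<open>q\<close> bounds the number of packed balls divided by
    \<open>s\<close> from below.\<close>
  define c where "c = q * (R / (16 * real ?d * \<rho>)) ^ ?d"
  have "q > 0" using gk \<kappa> by (simp add: q_def a_def)
  then have c: "c > 0" using R \<rho> by (simp add: c_def)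
  \<comment> \<open>The radius tends to 0, so the hypothesis of \<open>ball_packing\<close>
    eventually holds.\<close>
  have "((\<lambda>s. \<rho> * s powr (- 1 / real ?d)) \<longlongrightarrow> \<rho> * 0) at_top"
    by (intro tendsto_mult tendsto_const tendsto_neg_powr filterlim_ident) simp
  then have "\<forall>\<^sub>F s in at_top. \<rho> * s powr (- 1 / real ?d) < R / (16 * real ?d)"
    using R by (intro order_tendstoD) auto
  then have "\<forall>\<^sub>F s in at_top. prob_space.variance (M s) (\<lambda>\<omega>. F (r s) (\<eta> s \<omega>)) \<ge> c * s"
    using eventually_ge_at_top[of 1]
  proof eventually_elim
    case (elim s)
    then have s: "s \<ge> 1" by simp
    define t where "t = r s"
    have t: "t > 0" using \<rho> s by (simp add: t_def r)
    have "t < R / (16 * real ?d)" using elim by (simp add: t_def r)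
    then have tR: "16 * real ?d * t \<le> R" by (simp add: field_simps)
    have st: "s * t ^ ?d = \<rho> ^ ?d"
    proof -
      have "(s powr (- 1 / real ?d)) ^ ?d = s powr (- 1)" using s by (simp add: powr_power)
      then show ?thesis using s by (simp add: t_def r power_mult_distrib powr_minus)
    qed
    define \<mu> where "\<mu> = scale_measure (ennreal s) (density lborel (indicator W :: 'a \<Rightarrow> ennreal))"
    interpret rgg_functional F K g by (rule F)
    interpret poisson_process "M s" \<mu> "\<eta> s" unfolding \<mu>_def by (rule \<eta>[OF s])
    have em: "emeasure \<mu> B = ennreal s * emeasure lborel (B \<inter> W)" if "B \<in> sets borel" for B
      using that Wb by (simp add: \<mu>_def emeasure_density Int_commute flip: indicator_inter_arith)
    interpret rgg_poisson "M s" \<mu> "\<eta> s" F K g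
    proof
      show sets: "sets \<mu> = sets borel" by (simp add: \<mu>_def)
      have "space \<mu> = UNIV" using sets_eq_imp_space_eq[OF sets] by simp
      moreover have "emeasure lborel W < \<infinity>" using W(1) by (rule emeasure_compact_finite)
      ultimately show "emeasure \<mu> (space \<mu>) < \<infinity>"
        using em[of UNIV] by (simp add: ennreal_mult_less_top)
    qed
    have meas: "measure \<mu> B = s * measure lborel B" if "B \<in> sets borel" "B \<subseteq> W" for B
      using em[OF that(1)] that(2) s by (simp add: measure_def Int_absorb2 enn2real_mult)
    obtain P where P: "finite P" "\<And>x. x \<in> P \<Longrightarrow> ball x (2 * t) \<subseteq> ball z R"
      "disjoint_family_on (\<lambda>x. ball x (2 * t)) P"
      "(R / (16 * real ?d * t)) ^ ?d \<le> real (card P)"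
      using ball_packing[OF t tR, of z] by blast
    have sub: "ball x (t / 2) \<subseteq> ball x (2 * t)" for x :: 'a using t by (intro subset_ball) simp
    have vol: "measure \<mu> (ball x (u * t)) = \<kappa> * u ^ ?d" if "x \<in> P" "0 \<le> u" "u \<le> 2" for x u
    proof -
      have "ball x (u * t) \<subseteq> ball x (2 * t)" using that t by (intro subset_ball) simp
      then have "ball x (u * t) \<subseteq> W" using P(2)[OF that(1)] R(2) by blast
      then have "measure \<mu> (ball x (u * t)) = unit_ball_vol (real ?d) * u ^ ?d * (s * t ^ ?d)"
        using that t by (simp add: meas content_ball power_mult_distrib mult_ac)
      then show ?thesis by (simp add: st \<kappa>_def mult_ac)
    qed
    have "variance (\<lambda>\<omega>. F t (\<eta> s \<omega>)) \<ge> q * real (card P)"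
      unfolding q_def
    proof (rule variance_lower_bound[where C = "\<lambda>x. ball x (t / 2)" and
          S = "\<lambda>x. ball x (2 * t) - ball x (t / 2)"])
      show "disjoint_family_on (\<lambda>x. ball x (t / 2) \<union> (ball x (2 * t) - ball x (t / 2))) P"
        using P(3) sub by (simp add: Un_absorb1)
      show core: "measure \<mu> (ball x (t / 2)) = a" if "x \<in> P" for x
        using vol[OF that, of "1/2"] by (simp add: a_def)
      show "measure \<mu> (ball x (2 * t) - ball x (t / 2)) = b" if "x \<in> P" for x
      proof -
        have "measure \<mu> (ball x (2 * t) - ball x (t / 2)) =
          measure \<mu> (ball x (2 * t)) - measure \<mu> (ball x (t / 2))"
          using sub emeasure_intensity_finite[of "ball x (2 * t)"] emeasure_intensity_finite[of "ball x (t / 2)"]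
          by (intro measure_Diff) (auto simp: sets_intensity)
        then show ?thesis using vol[OF that, of 2] core[OF that] by (simp add: b_def)
      qed
      show "norm (v - w) \<le> t" if "v \<in> ball x (t / 2)" "w \<in> ball x (t / 2)" for x v w :: 'a
      proof -
        have "dist v w \<le> dist x v + dist x w" by (metis dist_commute dist_triangle)
        then show ?thesis using that by (simp add: dist_norm)
      qed
      show "norm (v - w) > t"
        if "v \<in> ball x (t / 2)" "w \<notin> ball x (t / 2) \<union> (ball x (2 * t) - ball x (t / 2))" for x v w :: 'a
      proof -
        \<comment> \<open>The gap exceeds \<open>2 * t - t / 2\<close>, hence
          \<open>t\<close>.\<close>
        have "2 * t \<le> dist x w" using that by auto
        moreover have "dist x w \<le> dist x v + dist v w" by (rule dist_triangle)
        ultimately have "t < dist v w" using that(1) t by simp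
        then show ?thesis by (simp add: dist_norm)
      qed
    qed (use P(1) in auto)
    moreover have "c * s \<le> q * real (card P)"
    proof -
      have "(R / (16 * real ?d * \<rho>)) ^ ?d * s = (R / (16 * real ?d * t)) ^ ?d"
        using st t \<rho> s by (simp add: power_divide power_mult_distrib field_simps flip: st)
      then show ?thesis
        using mult_left_mono[OF P(4), of q] \<open>q > 0\<close> by (simp add: c_def mult.assoc)
    qed
    ultimately show ?case by (simp add: t_def)
  qed
  with c show ?thesis by blast
qed

section \<open>Linear combinations as vertex sums\<close>

lemma degree_count_combination:
  "(\<Sum>i\<in>I. \<alpha> i * degree_count r (j i) X) =
    (\<Sum>y\<in>X. \<Sum>i\<in>I. \<alpha> i * of_bool (rgg_degree r X y = j i))"
  unfolding degree_count_def sum_distrib_left by (rule sum.swap)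

lemma component_count_combination:
  "(\<Sum>i\<in>I. \<alpha> i * component_count r (j i) X) =
    (\<Sum>y\<in>X. \<Sum>i\<in>I. (\<alpha> i / real (j i)) * of_bool (card (rgg_component r X y) = j i))"
  unfolding component_count_def sum_distrib_left
  by (subst sum.swap) (simp add: field_simps)

text \<open>Distinctness of the \<open>j i\<close> leaves a single term, so a nonzero coefficient
  produces a clique size with nonzero \<open>g\<close>.\<close>

lemma sum_coeff_of_bool:
  fixes \<beta> :: "'i \<Rightarrow> real"
  assumes "finite I" "inj_on j I" "i \<in> I"
  shows "(\<Sum>i'\<in>I. \<beta> i' * of_bool (j i = j i')) = \<beta> i"
proof -
  have "(\<Sum>i'\<in>I. \<beta> i' * of_bool (j i = j i')) = (\<Sum>i'\<in>I. if i = i' then \<beta> i' else 0)"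
    using assms by (intro sum.cong) (auto dest: inj_onD)
  then show ?thesis using assms by simp
qed

lemma abs_sum_coeff_of_bool_le:
  fixes \<beta> :: "'i \<Rightarrow> real"
  shows "\<bar>\<Sum>i\<in>I. \<beta> i * of_bool (P i)\<bar> \<le> (\<Sum>i\<in>I. \<bar>\<beta> i\<bar>)"
  by (rule order_trans[OF sum_abs]) (auto intro!: sum_mono simp: abs_mult)

theorem theorem3p1:
  fixes W :: "'a::euclidean_space set"
    and M :: "real \<Rightarrow> 'w measure"
    and \<eta> :: "real \<Rightarrow> 'w \<Rightarrow> 'a set"
    and \<rho> :: real
    and r :: "real \<Rightarrow> real"
    and n :: nat
  assumes "W \<noteq> {}" "compact W" "convex W" "emeasure lborel W > 0"
    and "\<And>s. s \<ge> 1 \<Longrightarrow>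
      poisson_process (M s) (scale_measure (ennreal s) (density lborel (indicator W))) (\<eta> s)"
    and "\<rho> > 0"
    and "\<And>s. s \<ge> 1 \<Longrightarrow> r s = \<rho> * s powr (- 1 / real DIM('a))"
    and "n \<ge> 1"
  shows
    "(\<forall>j :: nat \<Rightarrow> nat. inj_on j {1..n} \<longrightarrow>
       (\<forall>\<alpha> :: nat \<Rightarrow> real. (\<exists>i\<in>{1..n}. \<alpha> i \<noteq> 0) \<longrightarrow>
         (\<exists>c>0. \<forall>\<^sub>F s in at_top.
            prob_space.variance (M s) (\<lambda>\<omega>. \<Sum>i=1..n. \<alpha> i * degree_count (r s) (j i) (\<eta> s \<omega>))
              \<ge> c * s)))
     \<and>
     (\<forall>j :: nat \<Rightarrow> nat. inj_on j {1..n} \<and> (\<forall>i\<in>{1..n}. j i \<ge> 1) \<longrightarrow>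
       (\<forall>\<alpha> :: nat \<Rightarrow> real. (\<exists>i\<in>{1..n}. \<alpha> i \<noteq> 0) \<longrightarrow>
         (\<exists>c>0. \<forall>\<^sub>F s in at_top.
            prob_space.variance (M s) (\<lambda>\<omega>. \<Sum>i=1..n. \<alpha> i * component_count (r s) (j i) (\<eta> s \<omega>))
              \<ge> c * s)))"
proof (intro conjI allI impI)
  note variance = rgg_functional_variance[OF _ _ assms(2,3,4,5,6,7)]
  fix j :: "nat \<Rightarrow> nat" and \<alpha> :: "nat \<Rightarrow> real"
  assume j: "inj_on j {1..n}" and "\<exists>i\<in>{1..n}. \<alpha> i \<noteq> 0"
  then obtain i where i: "i \<in> {1..n}" "\<alpha> i \<noteq> 0" by blast
  show "\<exists>c>0. \<forall>\<^sub>F s in at_top. prob_space.variance (M s)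
      (\<lambda>\<omega>. \<Sum>i=1..n. \<alpha> i * degree_count (r s) (j i) (\<eta> s \<omega>)) \<ge> c * s"
    unfolding degree_count_combination
    \<comment> \<open>All points of a clique of \<open>Suc (j i)\<close> points have degree
      \<open>j i\<close>, so \<open>g k\<close> is \<open>Suc (j i)\<close> times
      \<open>\<alpha> i\<close>.\<close>
    by (rule variance[OF rgg_functional_degree[OF abs_sum_coeff_of_bool_le], where k = "Suc (j i)"])
      (use sum_coeff_of_bool[OF _ j i(1), of \<alpha>] i(2) in auto)
next
  note variance = rgg_functional_variance[OF _ _ assms(2,3,4,5,6,7)]
  fix j :: "nat \<Rightarrow> nat" and \<alpha> :: "nat \<Rightarrow> real"
  assume j: "inj_on j {1..n} \<and> (\<forall>i\<in>{1..n}. j i \<ge> 1)" and "\<exists>i\<in>{1..n}. \<alpha> i \<noteq> 0"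
  then obtain i where i: "i \<in> {1..n}" "\<alpha> i \<noteq> 0" by blast
  \<comment> \<open>Were \<open>j i\<close> zero, the coefficient
    \<open>\<alpha> i / real (j i)\<close> would be 0 by the convention for division.\<close>
  with j have "j i \<noteq> 0" by fastforce
  then show "\<exists>c>0. \<forall>\<^sub>F s in at_top. prob_space.variance (M s)
      (\<lambda>\<omega>. \<Sum>i=1..n. \<alpha> i * component_count (r s) (j i) (\<eta> s \<omega>)) \<ge> c * s"
    unfolding component_count_combination
    \<comment> \<open>A clique of \<open>j i\<close> points is one component of that size, so
      \<open>g k\<close> is \<open>\<alpha> i\<close> itself.\<close>
    by (intro variance[OF rgg_functional_component[OF abs_sum_coeff_of_bool_le], where k = "j i"])
      (use sum_coeff_of_bool[OF _ conjunct1[OF j] i(1), of "\<lambda>i. \<alpha> i / real (j i)"] i(2) in auto)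
qed

end
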